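(* Let $G$ be an Eulerian plane directed graph with vertex set $V$ and edge set $E$, let $r_0$ be a vertex of $G$, and let $\lambda_{G,r_0}$ be the greedoid polynomial of the branching greedoid of $G$ with root $r_0$. Then \[\lambda_{G,r_0}(t)=t^{|E|-|V|+1}\,I_{G^*}(t^{-1})=t^{|E|-|V|+1}(1-t^{-1})^{|E|-|V|+1}\,\mathrm{Ehr}_{\mathcal{Q}_{G^*}}(t^{-1}),\] where $I_{G^*}$ is the interior polynomial of the dual graph $G^*$ and, in the last expression, $(1-x)^{|E|-|V|+1}\mathrm{Ehr}_{\mathcal{Q}_{G^*}}(x)$ is understood as the polynomial it equals.
   Context: A directed graph is given by a finite graph with each edge oriented; $\overrightarrow{th}$ denotes an edge with tail $t$ and head $h$. All graphs are connected (in the undirected sense). The graph $G^*$ is assumed to have no loops and no multiple edges ($G$ may have some). A directed graph is Eulerian if the indegree equals the outdegree at every vertex. A plane directed graph is a directed graph embedded in the plane without edge crossings. Its dual $G^*$ has as underlying graph the usual planar dual, and the dual $\varepsilon^*$ of an edge $\varepsilon$ is oriented so that $\varepsilon$ has to be turned in the positive (counterclockwise) direction to obtain $\varepsilon^*$. If $G$ is Eulerian then $G^*$ is semi-balanced, i.e. each cycle (of the underlying undirected graph) has the same number of edges going in the two directions. For a directed graph $H=(V(H),E(H))$, $\mathcal{Q}_H=\mathrm{Conv}\{\mathbf{h}-\mathbf{t}\mid\overrightarrow{th}\in E(H)\}\subset\mathbf{R}^{V(H)}$, where $\mathbf{v}$ is the standard basis vector of $v$, and $\mathrm{Ehr}_{\mathcal{Q}_H}(t)=\sum_{k\ge0}|(k\cdot\mathcal{Q}_H)\cap\mathbf{Z}^{V(H)}|\,t^k$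 (with constant term $1$). The interior polynomial of a connected semi-balanced graph $H$ is the $h^*$-polynomial of $\mathcal{Q}_H$, that is, $I_H(t)=(1-t)^{\dim\mathcal{Q}_H+1}\mathrm{Ehr}_{\mathcal{Q}_H}(t)$, where $\dim\mathcal{Q}_H=|V(H)|-2$; $I_H=1$ if $H$ is a single point. An arborescence rooted at $r_0$ is a subgraph containing $r_0$ that is a tree in the undirected sense with each edge directed away from $r_0$; it is spanning if the tree is a spanning tree. The branching greedoid of $G$ with root $r_0$ has ground set $E(G)$, accessible sets the (edge sets of) arborescences rooted at $r_0$, and bases the spanning arborescences rooted at $r_0$. The dual complex of a greedoid is the abstract simplicial complex whose maximal simplices are the complements of the bases. The greedoid polynomial is $\lambda(t)=\sum_{i=0}^{m-r}h_i\,t^{m-r-i}$, where $(h_0,h_1,\dots)$ is the $h$-vector of the dual complex, $m$ is the cardinality of the ground set and $r$ is the common cardinality of the bases. Here the $h$-vector of a simplicial complex of dimension $d$ is defined by $\sum_i h_i x^{d+1-i}=f(x-1)$ with $f(y)=y^{d+1}+\sum_F y^{d-\dim F}$, the sum being over non-empty faces $F$. *)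

theory Defs
  imports
    "HOL-Complex_Analysis.Winding_Numbers"
    "HOL-Computational_Algebra.Polynomial_FPS"
    "Graph_Theory.Digraph_Component"
begin

section \<open>Plane directed graphs and their duals\<close>

text \<open>
  Vertices are drawn as distinct points, and an edge as a simple curve running from its tail to its
  head. A \<^const>\<open>simple_path\<close> may be closed, so the curve of a loop is a Jordan curve.
\<close>
locale plane_digraph = fin_digraph G
  for G :: "('v, 'e) pre_digraph" (structure) +
  fixes pos :: "'v \<Rightarrow> complex" and curve :: "'e \<Rightarrow> real \<Rightarrow> complex"
  assumes inj_pos: "inj_on pos (verts G)"
    and simple_curve: "e \<in> arcs G \<Longrightarrow> simple_path (curve e)"
    and curve_start: "e \<in> arcs G \<Longrightarrow> pathstart (curve e) = pos (tail G e)"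
    and curve_finish: "e \<in> arcs G \<Longrightarrow> pathfinish (curve e) = pos (head G e)"
    and curve_avoids_verts: "e \<in> arcs G \<Longrightarrow> curve e ` {0<..<1} \<inter> pos ` verts G = {}"
    and no_crossing: "\<lbrakk>e \<in> arcs G; e' \<in> arcs G; e \<noteq> e'\<rbrakk> \<Longrightarrow>
          curve e ` {0<..<1} \<inter> curve e' ` {0<..<1} = {}"

definition faces :: "('v, 'e) pre_digraph \<Rightarrow> ('v \<Rightarrow> complex) \<Rightarrow> ('e \<Rightarrow> real \<Rightarrow> complex) \<Rightarrow> complex set set"
  where "faces G pos curve =
    components (- (pos ` verts G \<union> (\<Union>e\<in>arcs G. path_image (curve e))))"

text \<open>
  \<open>L\<close> lies on the left and \<open>R\<close> on the right of the simple curve \<open>g\<close>. The curve is only continuous,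
  so there is no tangent vector to turn. Instead, \<open>g\<close> is closed up by a path \<open>c\<close> which avoids the
  interior point \<open>g t\<close> under consideration. Near \<open>g t\<close> the winding number of the
  closed curve is then larger by exactly one on the left of \<open>g\<close> than on the right: a
  counterclockwise Jordan curve winds once around the points on its left and does not wind around
  the points on its right.
\<close>
definition left_right :: "(real \<Rightarrow> complex) \<Rightarrow> complex set \<Rightarrow> complex set \<Rightarrow> bool"
  where "left_right g L R \<longleftrightarrow>
    (\<forall>t\<in>{0<..<1}. \<forall>c. path c \<and> pathstart c = pathfinish g \<and> pathfinish c = pathstart g
        \<and> g t \<notin> path_image c \<longrightarrow>
      (\<forall>\<epsilon>>0. \<exists>a \<in> L \<inter> ball (g t) \<epsilon>. \<exists>b \<in> R \<inter> ball (g t) \<epsilon>.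
        winding_number (g +++ c) a = winding_number (g +++ c) b + 1))"

text \<open>
  \<open>H\<close> is the dual of the plane digraph, its vertices being names for the faces, as given by the
  bijection \<open>face\<close>. (Names in a finite type make \<open>real ^ 'f\<close> available as the space of the root
  polytope.) The dual of the edge \<open>e\<close> is again called \<open>e\<close>. It is
  obtained from \<open>e\<close> by a counterclockwise turn, hence crosses \<open>e\<close> from right to left.
\<close>
definition is_dual_digraph :: "('v, 'e) pre_digraph \<Rightarrow> ('v \<Rightarrow> complex) \<Rightarrow> ('e \<Rightarrow> real \<Rightarrow> complex) \<Rightarrow>
    ('f \<Rightarrow> complex set) \<Rightarrow> ('f, 'e) pre_digraph \<Rightarrow> bool"
  where "is_dual_digraph G pos curve face H \<longleftrightarrow>
    bij_betw face (verts H) (faces G pos curve) \<and> arcs H = arcs G \<and>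
    (\<forall>e\<in>arcs G. tail H e \<in> verts H \<and> head H e \<in> verts H \<and>
       left_right (curve e) (face (head H e)) (face (tail H e)))"

definition eulerian :: "('v, 'e) pre_digraph \<Rightarrow> bool"
  where "eulerian G \<longleftrightarrow> (\<forall>v\<in>verts G. in_degree G v = out_degree G v)"


section \<open>Root polytopes and interior polynomials\<close>

definition root_polytope :: "('f::finite, 'e) pre_digraph \<Rightarrow> (real ^ 'f) set"
  where "root_polytope H = convex hull ((\<lambda>e. axis (head H e) 1 - axis (tail H e) 1) ` arcs H)"

definition ehrhart_series :: "(real ^ 'f::finite) set \<Rightarrow> real fps"
  where "ehrhart_series P = Abs_fps (\<lambda>k. if k = 0 then 1
    else of_nat (card {x \<in> (\<lambda>y. real k *\<^sub>R y) ` P. \<forall>i. x $ i \<in> \<int>}))"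

definition poly_of_fps :: "real fps \<Rightarrow> real poly"
  where "poly_of_fps f = (THE p. fps_of_poly p = f)"

definition h_star_series :: "(real ^ 'f::finite) set \<Rightarrow> real fps"
  where "h_star_series P = (1 - fps_X) ^ nat (aff_dim P + 1) * ehrhart_series P"

text \<open>
  If \<open>H\<close> is a single point then its root polytope is empty, with \<^const>\<open>aff_dim\<close> equal to \<open>-1\<close>,
  and this gives the constant polynomial \<open>1\<close>.
\<close>
definition interior_polynomial :: "('f::finite, 'e) pre_digraph \<Rightarrow> real poly"
  where "interior_polynomial H = poly_of_fps (h_star_series (root_polytope H))"


section \<open>Greedoid polynomials\<close>

text \<open>
  A greedoid is given by its ground set \<open>S\<close> and its family \<open>A\<close> of accessible sets, a simplicial
  complex by its set of faces including the empty one (so a face \<open>F\<close> has dimension \<open>card F - 1\<close>).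
\<close>

definition greedoid_bases :: "'e set set \<Rightarrow> 'e set set"
  where "greedoid_bases A = {B \<in> A. \<forall>C\<in>A. B \<subseteq> C \<longrightarrow> C = B}"

definition greedoid_rank :: "'e set set \<Rightarrow> nat"
  where "greedoid_rank A = (THE r. \<forall>B\<in>greedoid_bases A. card B = r)"

definition dual_complex :: "'e set \<Rightarrow> 'e set set \<Rightarrow> 'e set set"
  where "dual_complex S A = {F. \<exists>B\<in>greedoid_bases A. F \<subseteq> S - B}"

definition dim_plus_1 :: "'e set set \<Rightarrow> nat"
  where "dim_plus_1 \<Delta> = Max (card ` \<Delta>)"

definition f_polynomial :: "'e set set \<Rightarrow> int poly"
  where "f_polynomial \<Delta> =
    monom 1 (dim_plus_1 \<Delta>) + (\<Sum>F\<in>\<Delta> - {{}}. monom 1 (dim_plus_1 \<Delta> - card F))"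

definition h_vector :: "'e set set \<Rightarrow> nat \<Rightarrow> int"
  where "h_vector \<Delta> i = coeff (pcompose (f_polynomial \<Delta>) [:-1, 1:]) (dim_plus_1 \<Delta> - i)"

definition greedoid_polynomial :: "'e set \<Rightarrow> 'e set set \<Rightarrow> real poly"
  where "greedoid_polynomial S A =
    (let m = card S; r = greedoid_rank A
     in \<Sum>i\<le>m - r. monom (of_int (h_vector (dual_complex S A) i)) (m - r - i))"


section \<open>The branching greedoid\<close>

text \<open>
  The library's \<^const>\<open>forest\<close> and \<^const>\<open>tree\<close> only exclude directed cycles, and passing
  to \<^const>\<open>mk_symmetric\<close> would make every edge a cycle of length two. The following cycles are
  those of the underlying undirected multigraph, including loops and pairs of parallel edges.
\<close>
definition undirected_cycle :: "('v, 'e) pre_digraph \<Rightarrow> 'v list \<Rightarrow> 'e list \<Rightarrow> bool"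
  where "undirected_cycle G vs es \<longleftrightarrow>
    es \<noteq> [] \<and> length vs = length es \<and> distinct vs \<and> distinct es \<and> set es \<subseteq> arcs G \<and>
    (\<forall>i<length es. {tail G (es ! i), head G (es ! i)} = {vs ! i, vs ! (Suc i mod length es)})"

definition undirected_tree :: "('v, 'e) pre_digraph \<Rightarrow> bool"
  where "undirected_tree T \<longleftrightarrow>
    Digraph_Component.connected T \<and> (\<nexists>vs es. undirected_cycle T vs es)"

text \<open>
  In a tree, an edge is directed away from the root if its tail is still connected with the root
  once the edge is removed.
\<close>
definition arborescence :: "('v, 'e) pre_digraph \<Rightarrow> 'v \<Rightarrow> ('v, 'e) pre_digraph \<Rightarrow> bool"
  where "arborescence G r T \<longleftrightarrow>
    subgraph T G \<and> r \<in> verts T \<and> undirected_tree T \<and>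
    (\<forall>e\<in>arcs T. r \<rightarrow>\<^sup>*\<^bsub>with_proj (mk_symmetric (pre_digraph.del_arc T e))\<^esub> tail T e)"

definition branching_greedoid :: "('v, 'e) pre_digraph \<Rightarrow> 'v \<Rightarrow> 'e set set"
  where "branching_greedoid G r = {arcs T |T. arborescence G r T}"

definition branching_polynomial :: "('v, 'e) pre_digraph \<Rightarrow> 'v \<Rightarrow> real poly"
  where "branching_polynomial G r = greedoid_polynomial (arcs G) (branching_greedoid G r)"

end

theory Submission
  imports Defs
begin

text \<open>
  The complements of the spanning arborescences rooted at \<open>r0\<close> are the facets of a unimodular
  triangulation of the root polytope \<open>Q\<close> of the dual. So the \<open>h\<^sup>*\<close>-polynomial of \<open>Q\<close> is the
  \<open>h\<close>-polynomial of the dual complex of the branching greedoid, and the greedoid polynomial lists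
  the same coefficients in reverse order. The triangulation itself is never constructed; what is
  used is its effect on lattice points, as follows.

  Let \<open>w e\<close> be the head minus the tail of the dual arc \<open>e\<close>. By planar duality the coboundaries of
  functions on the faces are exactly the circulations of \<open>G\<close> (\<open>circulation_imp_dual_coboundary\<close>,
  \<open>dual_coboundary_circulation\<close>). Hence the linear relations between the vectors \<open>w e\<close> are the
  differences of potentials on the vertices of \<open>G\<close>, and a point of \<open>k Q\<close> is a class of nonnegative
  weights on the arcs, of total \<open>k\<close>, modulo potential differences; the total does not depend on the
  representative because \<open>G\<close> is Eulerian. Read the weights as lengths. Correcting them by the
  distance from \<open>r0\<close> gives a nonnegative representative whose zero arcs contain a
  spanning arborescence rooted at \<open>r0\<close>, and there is only one such representative
  (\<open>normal_form_exists\<close>, \<open>normal_form_unique\<close>). If the point is a lattice point then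
  this representative is integral, since the weights of the arcs off a tree are coordinates given
  by circulations (\<open>comb_Ints_imp_Ints\<close>).

  So the lattice points of \<open>k Q\<close> correspond to the natural weights of total \<open>k\<close> supported on a face
  of the dual complex \<open>\<Delta>\<close> (\<open>normal_points_bij\<close>), and the Ehrhart series is the sum over \<open>F \<in> \<Delta>\<close> of
  \<open>(t / (1 - t)) ^ card F\<close>. Multiplied by \<open>(1 - t) ^ n\<close>, with \<open>n\<close> the number of arcs off a tree, it
  becomes the sum of \<open>t ^ card F * (1 - t) ^ (n - card F)\<close>, while the greedoid polynomial is the sum
  of \<open>(t - 1) ^ (n - card F)\<close> (\<open>poly_greedoid_polynomial\<close>). Substituting \<open>1 / t\<close> in the former and
  multiplying by \<open>t ^ n\<close> gives the latter.

  For the planar duality, a circulation is turned into a function on the faces by summing winding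
  numbers of the arcs, weighted by the circulation. Conversely, a function on the faces is compared
  with the one of a circulation that agrees with its coboundary off a spanning tree; the two differ
  by a constant because the tree does not separate the plane, so that any two faces are
  joined by crossing arcs off the tree. Here Janiszewski's theorem shows both that the tree does not
  separate the plane and that at most two faces touch the interior of an arc off the tree.
\<close>

section \<open>Growing arborescences, circulations and potentials\<close>

text \<open>
  A spanning arborescence will always be used through the order in which it can be grown from
  its root. The set of vertices reached so far is carried along, so that spanning
  means that this set is \<open>verts G\<close>.
\<close>
inductive grown :: "('v, 'e) pre_digraph \<Rightarrow> 'v \<Rightarrow> 'v set \<Rightarrow> 'e set \<Rightarrow> bool"
  for G r where
  root: "grown G r {r} {}"
| step: "\<lbrakk>grown G r R A; e \<in> arcs G; tail G e \<in> R; head G e \<notin> R\<rbrakk>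
    \<Longrightarrow> grown G r (insert (head G e) R) (insert e A)"

lemma grown_facts:
  assumes "grown G r R A"
  shows "r \<in> R" "A \<subseteq> arcs G" "finite R" "finite A" "card R = Suc (card A)"
    "\<And>e. e \<in> A \<Longrightarrow> tail G e \<in> R" "\<And>e. e \<in> A \<Longrightarrow> head G e \<in> R"
  using assms
proof (induction rule: grown.induct)
  case (step R A e)
  { case 5
    then have "e \<notin> A" using step by auto
    then show ?case using step by simp }
qed auto

definition circulation :: "('v, 'e) pre_digraph \<Rightarrow> ('e \<Rightarrow> 'a::comm_ring_1) \<Rightarrow> bool"
  where "circulation G x \<longleftrightarrow> (\<forall>v\<in>verts G. sum x (in_arcs G v) = sum x (out_arcs G v))"

lemma eulerian_iff_circulation: "eulerian G \<longleftrightarrow> circulation G (\<lambda>_. 1 :: 'a::{comm_ring_1, ring_char_0})"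
  by (simp add: eulerian_def circulation_def in_degree_def out_degree_def)

lemma circulation_of_int: "circulation G x \<Longrightarrow> circulation G (\<lambda>e. of_int (x e))"
  unfolding circulation_def by (simp flip: of_int_sum)

context fin_digraph
begin

lemma grown_verts:
  assumes "grown G r R A" "r \<in> verts G"
  shows "R \<subseteq> verts G"
  using assms by (induction rule: grown.induct) auto

lemma sum_arcs_by_head:
  fixes x :: "'b \<Rightarrow> 'c::comm_ring_1"
  shows "(\<Sum>e\<in>arcs G. x e * q (head G e)) = (\<Sum>v\<in>verts G. sum x (in_arcs G v) * q v)"
proof -
  have "(\<Sum>e\<in>arcs G. x e * q (head G e))
      = (\<Sum>v\<in>verts G. \<Sum>e\<in>{e\<in>arcs G. head G e = v}. x e * q (head G e))"
    by (rule sum.group[symmetric]) auto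
  then show ?thesis
    by (simp add: in_arcs_def sum_distrib_right)
qed

lemma sum_arcs_by_tail:
  fixes x :: "'b \<Rightarrow> 'c::comm_ring_1"
  shows "(\<Sum>e\<in>arcs G. x e * q (tail G e)) = (\<Sum>v\<in>verts G. sum x (out_arcs G v) * q v)"
proof -
  have "(\<Sum>e\<in>arcs G. x e * q (tail G e))
      = (\<Sum>v\<in>verts G. \<Sum>e\<in>{e\<in>arcs G. tail G e = v}. x e * q (tail G e))"
    by (rule sum.group[symmetric]) auto
  then show ?thesis
    by (simp add: out_arcs_def sum_distrib_right)
qed

lemma sum_arcs_diff:
  fixes x :: "'b \<Rightarrow> 'c::comm_ring_1"
  shows "(\<Sum>e\<in>arcs G. x e * (q (head G e) - q (tail G e)))
    = (\<Sum>v\<in>verts G. (sum x (in_arcs G v) - sum x (out_arcs G v)) * q v)"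
  by (simp add: right_diff_distrib left_diff_distrib sum_subtractf sum_arcs_by_head sum_arcs_by_tail)

lemma circulation_orthogonal:
  fixes x :: "'b \<Rightarrow> 'c::comm_ring_1"
  assumes "circulation G x"
  shows "(\<Sum>e\<in>arcs G. x e * (q (head G e) - q (tail G e))) = 0"
  using assms by (simp add: sum_arcs_diff circulation_def)

text \<open>
  The form in which connectedness enters: no nonempty proper set of vertices is closed under
  crossing arcs in either direction.
\<close>
lemma connected_closed_verts:
  assumes "Digraph_Component.connected G" "r \<in> R" "r \<in> verts G"
    and closed: "\<And>e. e \<in> arcs G \<Longrightarrow> tail G e \<in> R \<longleftrightarrow> head G e \<in> R"
  shows "verts G \<subseteq> R"
proof
  fix v assume "v \<in> verts G"
  with assms have "r \<rightarrow>\<^sup>*\<^bsub>with_proj (mk_symmetric G)\<^esub> v"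
    by (auto simp: Digraph_Component.connected_def strongly_connected_def mk_symmetric_def)
  then show "v \<in> R"
    using \<open>r \<in> R\<close> unfolding reachable_def
  proof (induction rule: rtrancl_on.induct)
    case (rtrancl_on_into_rtrancl_on u w)
    then show ?case using closed by (auto simp: arcs_ends_def arc_to_ends_def mk_symmetric_def)
  qed (use assms in auto)
qed

text \<open>
  As many arcs enter a set of vertices as leave it, because the constant 1 is a circulation. If none
  left it, none would enter it either, against connectedness.
\<close>
lemma eulerian_leaving_arc:
  assumes "eulerian G" "Digraph_Component.connected G" "r \<in> R" "r \<in> verts G" "\<not> verts G \<subseteq> R"
  shows "\<exists>e\<in>arcs G. tail G e \<in> R \<and> head G e \<notin> R"
proof (rule ccontr)
  assume neg: "\<not> ?thesis"
  define q :: "'a \<Rightarrow> int" where "q v = (if v \<in> R then 1 else 0)" for v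
  have nn: "q (head G e) - q (tail G e) \<ge> 0" if "e \<in> arcs G" for e
    using neg that by (auto simp: q_def)
  have "(\<Sum>e\<in>arcs G. q (head G e) - q (tail G e)) = 0"
    using circulation_orthogonal[of "\<lambda>_. 1 :: int" q] assms(1)
    by (simp add: eulerian_iff_circulation[where 'a=int])
  then have "\<forall>e\<in>arcs G. q (head G e) - q (tail G e) = 0"
    using nn by (subst (asm) sum_nonneg_eq_0_iff) auto
  then have "verts G \<subseteq> R"
    using assms by (intro connected_closed_verts[of r R]) (auto simp: q_def split: if_splits)
  with assms show False by blast
qed

lemma grown_extend:
  assumes "eulerian G" "Digraph_Component.connected G" "r \<in> verts G" "grown G r R A" "R \<noteq> verts G"
  obtains e where "e \<in> arcs G" "tail G e \<in> R" "head G e \<notin> R"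
proof -
  have "\<not> verts G \<subseteq> R" using assms grown_verts by blast
  then show ?thesis
    using eulerian_leaving_arc[of r R] grown_facts(1)[OF assms(4)] assms that by blast
qed

lemma grown_potential:
  fixes z :: "'b \<Rightarrow> 'c::ab_group_add"
  assumes "grown G r R A"
  shows "\<exists>q. \<forall>e\<in>A. q (head G e) - q (tail G e) = z e"
  using assms
proof (induction rule: grown.induct)
  case (step R A e)
  then obtain q where q: "\<forall>e\<in>A. q (head G e) - q (tail G e) = z e" by blast
  have "\<forall>a\<in>insert e A. (q(head G e := q (tail G e) + z e)) (head G a)
      - (q(head G e := q (tail G e) + z e)) (tail G a) = z a"
  proof
    fix a assume "a \<in> insert e A"
    then show "(q(head G e := q (tail G e) + z e)) (head G a)
      - (q(head G e := q (tail G e) + z e)) (tail G a) = z a"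
      using q step.hyps grown_facts(6,7)[OF step.hyps(1), of a] by (cases "a = e") auto
  qed
  then show ?case by blast
qed auto

text \<open>
  The demands of the vertices are met from the root along the tree: a new leaf is
  served through its only arc, whose tail has to ask for that amount in addition.
\<close>
lemma grown_flow:
  fixes b :: "'a \<Rightarrow> 'c::comm_ring_1"
  assumes "grown G r R A"
  shows "\<exists>x. (\<forall>e. e \<notin> A \<longrightarrow> x e = 0) \<and>
    (\<forall>v\<in>R - {r}. sum x (in_arcs G v) - sum x (out_arcs G v) = b v)"
  using assms
proof (induction arbitrary: b rule: grown.induct)
  case (step R A e)
  let ?t = "tail G e" and ?h = "head G e"
  obtain x where x0: "\<And>a. a \<notin> A \<Longrightarrow> x a = 0" and
    xb: "\<And>v. v \<in> R - {r} \<Longrightarrow> sum x (in_arcs G v) - sum x (out_arcs G v) = (b(?t := b ?t + b ?h)) v"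
    using step.IH[of "b(?t := b ?t + b ?h)"] by metis
  have eA: "e \<notin> A" using step grown_facts(7)[OF step(1)] by blast
  define y where "y = x(e := b ?h)"
  have y: "sum y B = sum x B + (if e \<in> B then b ?h else 0)" if "finite B" for B
  proof -
    have "sum y B = sum (\<lambda>a. x a + (if a = e then b ?h else 0)) B"
      by (rule sum.cong) (auto simp: y_def x0 eA)
    then show ?thesis using that by (simp add: sum.distrib)
  qed
  have "sum y (in_arcs G v) - sum y (out_arcs G v) = b v" if v: "v \<in> insert ?h R - {r}" for v
  proof (cases "v = ?h")
    case True
    have "sum x (in_arcs G ?h) = 0" "sum x (out_arcs G ?h) = 0"
      using x0 grown_facts(6,7)[OF step(1)] step.hyps
      by (metis in_in_arcs_conv sum.neutral, metis in_out_arcs_conv sum.neutral)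
    moreover have "?t \<noteq> ?h" using step.hyps by auto
    ultimately show ?thesis
      using True step.hyps by (simp add: y finite_in_arcs finite_out_arcs)
  next
    case False
    with v have "v \<in> R - {r}" by auto
    from xb[OF this] show ?thesis using False step.hyps
      by (auto simp: y finite_in_arcs finite_out_arcs algebra_simps)
  qed
  moreover have "\<forall>a. a \<notin> insert e A \<longrightarrow> y a = 0" by (auto simp: y_def x0)
  ultimately show ?case by blast
qed auto

lemma circulation_extending:
  fixes y :: "'b \<Rightarrow> 'c::comm_ring_1"
  assumes "grown G r (verts G) A"
  obtains x where "circulation G x" "\<And>e. e \<notin> A \<Longrightarrow> x e = y e"
proof -
  define y' where "y' e = (if e \<in> A then 0 else y e)" for e
  obtain u where u0: "\<And>e. e \<notin> A \<Longrightarrow> u e = 0" and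
    ub: "\<And>v. v \<in> verts G - {r} \<Longrightarrow> sum u (in_arcs G v) - sum u (out_arcs G v)
        = sum y' (out_arcs G v) - sum y' (in_arcs G v)"
    using grown_flow[OF assms, of "\<lambda>v. sum y' (out_arcs G v) - sum y' (in_arcs G v)"] by blast
  define x where "x e = u e + y' e" for e
  have bal: "sum x (in_arcs G v) - sum x (out_arcs G v) = 0" if "v \<in> verts G - {r}" for v
    using ub[OF that] by (simp add: x_def sum.distrib algebra_simps)
  \<comment> \<open>The surpluses of all vertices add up to zero, so the root is balanced as well.\<close>
  have "(\<Sum>v\<in>verts G. sum x (in_arcs G v) - sum x (out_arcs G v)) = 0"
    using sum_arcs_diff[of x "\<lambda>_. 1"] by simp
  moreover have r: "r \<in> verts G" using grown_facts(1)[OF assms] .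
  ultimately have "sum x (in_arcs G r) - sum x (out_arcs G r) = 0"
    using bal sum.remove[OF _ r, of "\<lambda>v. sum x (in_arcs G v) - sum x (out_arcs G v)"] by simp
  with bal have "circulation G x" unfolding circulation_def by force
  then show ?thesis using that u0 by (simp add: x_def y'_def)
qed

text \<open>
  This is the algorithm of Dijkstra with the distance as the potential: raise the potential outside
  the set reached so far until the first leaving arc becomes tight, and grow the arborescence
  by that arc. Entering arcs only gain, and arcs inside the set do not change.
\<close>
lemma normal_form_exists:
  fixes y :: "'b \<Rightarrow> real"
  assumes "eulerian G" "Digraph_Component.connected G" "r \<in> verts G"
    and "\<And>e. e \<in> arcs G \<Longrightarrow> 0 \<le> y e"
  shows "\<exists>q A. grown G r (verts G) A \<and>
    (\<forall>e\<in>arcs G. 0 \<le> y e - (q (head G e) - q (tail G e))) \<and>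
    (\<forall>e\<in>A. y e - (q (head G e) - q (tail G e)) = 0)"
proof -
  define ok where "ok q R A \<longleftrightarrow> grown G r R A \<and>
    (\<forall>e\<in>arcs G. 0 \<le> y e - (q (head G e) - q (tail G e))) \<and>
    (\<forall>e\<in>A. y e - (q (head G e) - q (tail G e)) = 0)" for q R A
  have greedy: "\<exists>q' A'. ok q' (verts G) A'" if "ok q R A" for q R A
    using that
  proof (induction "card (verts G - R)" arbitrary: q R A rule: less_induct)
    case less
    have gr: "grown G r R A" and nn: "\<And>e. e \<in> arcs G \<Longrightarrow> 0 \<le> y e - (q (head G e) - q (tail G e))"
      and z: "\<And>e. e \<in> A \<Longrightarrow> y e - (q (head G e) - q (tail G e)) = 0"
      using less.prems unfolding ok_def by blast+
    show ?case
    proof (cases "R = verts G")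
      case True
      with less.prems show ?thesis by auto
    next
      case False
      define D where "D = {e \<in> arcs G. tail G e \<in> R \<and> head G e \<notin> R}"
      obtain d where "d \<in> arcs G" "tail G d \<in> R" "head G d \<notin> R"
        using grown_extend[OF assms(1-3) gr False] .
      then have "D \<noteq> {}" unfolding D_def by blast
      moreover have "finite D" by (simp add: D_def)
      ultimately obtain e where
        "is_arg_min (\<lambda>f. y f - (q (head G f) - q (tail G f))) (\<lambda>f. f \<in> D) e"
        using ex_is_arg_min_if_finite by blast
      then have e: "e \<in> D" and
        emin: "\<And>f. f \<in> D \<Longrightarrow> y e - (q (head G e) - q (tail G e)) \<le> y f - (q (head G f) - q (tail G f))"
        by (simp_all add: is_arg_min_linorder)
      define m where "m = y e - (q (head G e) - q (tail G e))"
      define q' where "q' v = q v + (if v \<in> R then 0 else m)" for v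
      have "m \<ge> 0" using nn e by (simp add: m_def D_def)
      have "ok q' (insert (head G e) R) (insert e A)"
        unfolding ok_def
      proof (intro conjI ballI)
        show "grown G r (insert (head G e) R) (insert e A)"
          using e by (intro grown.step[OF gr]) (auto simp: D_def)
        show "0 \<le> y f - (q' (head G f) - q' (tail G f))" if "f \<in> arcs G" for f
        proof (cases "f \<in> D")
          case True
          then show ?thesis using emin[of f] by (simp add: q'_def D_def m_def)
        next
          case False
          then show ?thesis using nn[OF that] that \<open>m \<ge> 0\<close> by (auto simp: q'_def D_def)
        qed
        show "y f - (q' (head G f) - q' (tail G f)) = 0" if "f \<in> insert e A" for f
        proof (cases "f = e")
          case True
          then show ?thesis using e by (auto simp: q'_def D_def m_def)
        next
          case False
          then show ?thesis using that z[of f] grown_facts(6,7)[OF gr, of f] by (auto simp: q'_def)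
        qed
      qed
      moreover have "card (verts G - insert (head G e) R) < card (verts G - R)"
      proof -
        have "head G e \<in> verts G - R" using e by (simp add: D_def)
        then show ?thesis by (metis Diff_insert card_Diff1_less finite_Diff finite_verts)
      qed
      ultimately show ?thesis by (rule less.hyps[rotated])
    qed
  qed
  have "ok (\<lambda>_. 0) {r} {}" using assms by (auto simp: ok_def intro: grown.root)
  from greedy[OF this] show ?thesis unfolding ok_def .
qed

text \<open>
  Along the zero arcs of \<open>x\<close> the potential \<open>q\<close> cannot increase, so its value is largest at the
  root; along the zero arcs of \<open>x'\<close> it cannot decrease. Hence it is constant. In terms of
  distances: both weights have all distances from the root equal to zero.
\<close>
lemma normal_form_unique:
  fixes x x' :: "'b \<Rightarrow> real"
  assumes "grown G r (verts G) A" "grown G r (verts G) A'"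
    and "\<And>e. e \<in> arcs G \<Longrightarrow> 0 \<le> x e" "\<And>e. e \<in> arcs G \<Longrightarrow> 0 \<le> x' e"
    and "\<And>e. e \<in> A \<Longrightarrow> x e = 0" "\<And>e. e \<in> A' \<Longrightarrow> x' e = 0"
    and diff: "\<And>e. e \<in> arcs G \<Longrightarrow> x e - x' e = q (head G e) - q (tail G e)"
    and "e \<in> arcs G"
  shows "x e = x' e"
proof -
  have along: "s * q v \<le> s * q r"
    if "grown G r R B" "v \<in> R" "\<And>f. f \<in> B \<Longrightarrow> s * (q (head G f) - q (tail G f)) \<le> 0" for R B v s
    using that
  proof (induction arbitrary: v rule: grown.induct)
    case (step R A e)
    have "s * (q (head G e) - q (tail G e)) \<le> 0" using step.prems(2) by blast
    moreover have "s * q (tail G e) \<le> s * q r" using step by blast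
    ultimately have "s * q (head G e) \<le> s * q r" by (simp add: right_diff_distrib)
    with step show ?case by blast
  qed auto
  have "q v = q r" if "v \<in> verts G" for v
  proof (rule antisym)
    show "q v \<le> q r"
      using along[OF assms(1) that, of 1] diff assms(4,5) grown_facts(2)[OF assms(1)]
      by (smt (verit) mult_cancel_right2 subset_iff)
    show "q r \<le> q v"
      using along[OF assms(2) that, of "-1"] diff assms(3,6) grown_facts(2)[OF assms(2)]
      by (smt (verit) mult_minus1 subset_iff)
  qed
  then show ?thesis using diff[OF assms(8)] assms(8) by simp
qed

end

section \<open>Duality of plane digraphs\<close>

lemma cmod_diff_Ints_ge_1:
  assumes "a \<in> \<int>" "b \<in> \<int>" "a \<noteq> b"
  shows "1 \<le> cmod (a - b)"
  using assms by (auto simp: Ints_def simp flip: of_int_diff)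

context plane_digraph
begin

definition drawing :: "'e set \<Rightarrow> complex set"
  where "drawing B = pos ` verts G \<union> (\<Union>e\<in>B. path_image (curve e))"

text \<open>
  The winding numbers of the single arcs are not integers, but for a circulation their sum is.
  For the circulation of a cycle this is the winding number of the cycle; taking all circulations at
  once avoids decomposing them into cycles.
\<close>
definition winding_sum :: "('e \<Rightarrow> int) \<Rightarrow> complex \<Rightarrow> complex"
  where "winding_sum x z = (\<Sum>e\<in>arcs G. of_int (x e) * winding_number (curve e) z)"

lemma path_curve: "e \<in> arcs G \<Longrightarrow> path (curve e)"
  using simple_curve simple_path_imp_path by blast

lemma path_image_curve:
  assumes "e \<in> arcs G"
  shows "path_image (curve e) = {pos (tail G e), pos (head G e)} \<union> curve e ` {0<..<1}"
proof -
  have "{0..1::real} = {0, 1} \<union> {0<..<1}" by auto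
  then show ?thesis
    using curve_start[OF assms] curve_finish[OF assms]
    by (auto simp: path_image_def pathstart_def pathfinish_def)
qed

lemma interior_not_vertex:
  assumes "e \<in> arcs G" "t \<in> {0<..<1}" "v \<in> verts G"
  shows "curve e t \<noteq> pos v"
  using curve_avoids_verts[OF assms(1)] assms by blast

lemma interior_not_other_arc:
  assumes "e \<in> arcs G" "f \<in> arcs G" "e \<noteq> f" "t \<in> {0<..<1}"
  shows "curve e t \<notin> path_image (curve f)"
  using no_crossing[OF assms(1-3)] interior_not_vertex[OF assms(1,4)] assms
  unfolding path_image_curve[OF assms(2)] by (metis Un_iff disjoint_iff imageI insertE empty_iff tail_in_verts head_in_verts)

lemma compact_curves:
  assumes "finite R" "B \<subseteq> arcs G"
  shows "compact (pos ` R \<union> (\<Union>e\<in>B. path_image (curve e)))"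
proof (rule compact_Un)
  show "compact (pos ` R)" using assms(1) by (simp add: finite_imp_compact)
  have "finite B" using assms(2) finite_arcs finite_subset by blast
  then show "compact (\<Union>e\<in>B. path_image (curve e))"
    using assms(2) path_curve by (intro compact_UN compact_path_image) auto
qed

lemma compact_drawing: "B \<subseteq> arcs G \<Longrightarrow> compact (drawing B)"
  unfolding drawing_def by (rule compact_curves) simp_all

lemma faces_drawing: "faces G pos curve = components (- drawing (arcs G))"
  by (simp add: faces_def drawing_def)

text \<open>
  Choose a logarithm \<open>l v\<close> of \<open>pos v - z\<close> for every vertex. Up to an integer, the winding number of an
  arc is the difference of the logarithms at its ends divided by \<open>2 * pi * \<i>\<close>, and these
  differences are orthogonal to circulations.
\<close>
lemma winding_sum_Ints:
  assumes "circulation G x" "z \<notin> drawing (arcs G)"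
  shows "winding_sum x z \<in> \<int>"
proof -
  define l where "l v = Ln (pos v - z)" for v
  have l: "exp (l v) = pos v - z" if "v \<in> verts G" for v
    using assms(2) that by (auto simp: l_def drawing_def intro!: exp_Ln)
  have "\<exists>k::int. winding_number (curve e) z = (l (head G e) - l (tail G e)) / (2 * of_real pi * \<i>) + of_int k"
    if e: "e \<in> arcs G" for e
  proof -
    have "z \<notin> path_image (curve e)" using assms(2) e by (auto simp: drawing_def)
    from winding_number_exp_2pi[OF path_curve[OF e] this]
    have "exp (l (head G e)) = exp (2 * of_real pi * \<i> * winding_number (curve e) z + l (tail G e))"
      using e by (simp add: curve_start curve_finish l exp_add)
    then obtain n :: int where "l (head G e) = 2 * of_real pi * \<i> * winding_number (curve e) z + l (tail G e)
        + (of_int (2 * n) * pi) * \<i>"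
      unfolding exp_eq by blast
    then have "winding_number (curve e) z = (l (head G e) - l (tail G e)) / (2 * of_real pi * \<i>) + of_int (- n)"
      by (simp add: field_simps)
    then show ?thesis by blast
  qed
  then obtain k :: "'e \<Rightarrow> int" where k: "\<And>e. e \<in> arcs G \<Longrightarrow>
      winding_number (curve e) z = (l (head G e) - l (tail G e)) / (2 * of_real pi * \<i>) + of_int (k e)"
    by metis
  have "winding_sum x z = (\<Sum>e\<in>arcs G. of_int (x e) * (l (head G e) - l (tail G e))) / (2 * of_real pi * \<i>)
      + of_int (\<Sum>e\<in>arcs G. x e * k e)"
    by (simp add: winding_sum_def k distrib_left sum.distrib sum_divide_distrib)
  also have "\<dots> = of_int (\<Sum>e\<in>arcs G. x e * k e)"
    by (simp add: circulation_orthogonal[OF circulation_of_int[OF assms(1)]])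
  finally show ?thesis by (metis Ints_of_int)
qed

lemma winding_sum_constant_on_face:
  assumes "circulation G x" "F \<in> faces G pos curve"
  shows "winding_sum x constant_on F"
proof -
  have sub: "F \<subseteq> - drawing (arcs G)"
    using assms(2) in_components_subset by (auto simp: faces_drawing)
  have *: "1 \<le> cmod (winding_sum x y - winding_sum x z)"
    if "winding_sum x y \<noteq> winding_sum x z" "y \<in> F" "z \<in> F" for y z
  proof -
    have "winding_sum x y \<in> \<int>" "winding_sum x z \<in> \<int>"
      using winding_sum_Ints[OF assms(1)] sub that by auto
    with that show ?thesis by (simp add: cmod_diff_Ints_ge_1)
  qed
  have "continuous_on F (winding_sum x)"
    unfolding winding_sum_def using sub
    by (intro continuous_intros continuous_on_subset[OF continuous_on_winding_number] path_curve)
       (auto simp: drawing_def)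
  moreover have "Topological_Spaces.connected F"
    using assms(2) in_components_connected by (auto simp: faces_drawing)
  ultimately show ?thesis
    using * zero_less_one by (blast intro: continuous_discrete_range_constant)
qed

text \<open>
  Close the arc \<open>e\<close> up to a loop by a path \<open>c\<close> that avoids a point \<open>p\<close> in the interior of the arc. When
  \<open>x e\<close> times the winding number of the loop is subtracted from the winding sum, what remains involves
  only paths that avoid \<open>p\<close>; it is continuous and integral near \<open>p\<close>, hence has the same value
  on both sides. The jump of the loop is one by definition of the sides.
\<close>
lemma winding_sum_jump:
  assumes x: "circulation G x" and e: "e \<in> arcs G" and LR: "left_right (curve e) L R"
    and L: "L \<in> faces G pos curve" and R: "R \<in> faces G pos curve" and "a \<in> L" "b \<in> R"
  shows "winding_sum x a - winding_sum x b = of_int (x e)"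
proof -
  define p where "p = curve e (1/2)"
  have "path_connected (- {p})" by (rule path_connected_punctured_universe) simp
  moreover have "pos (head G e) \<in> - {p}" "pos (tail G e) \<in> - {p}"
    using interior_not_vertex[OF e, of "1/2"] e by (force simp: p_def)+
  ultimately obtain c where c: "path c" "path_image c \<subseteq> - {p}" "pathstart c = pos (head G e)"
    "pathfinish c = pos (tail G e)"
    unfolding path_connected_def by blast
  define \<psi> where "\<psi> z = (\<Sum>f\<in>arcs G - {e}. of_int (x f) * winding_number (curve f) z)
      - of_int (x e) * winding_number c z" for z
  have loop: "path (curve e +++ c)" "pathfinish (curve e +++ c) = pathstart (curve e +++ c)"
    using c e by (auto simp: path_curve curve_start curve_finish)
  have \<psi>_eq: "\<psi> z = winding_sum x z - of_int (x e) * winding_number (curve e +++ c) z"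
    if "z \<notin> drawing (arcs G)" "z \<notin> path_image c" for z
  proof -
    have "winding_number (curve e +++ c) z = winding_number (curve e) z + winding_number c z"
      using c e that by (intro winding_number_join) (auto simp: path_curve curve_finish drawing_def)
    then show ?thesis
      using e by (simp add: \<psi>_def winding_sum_def sum.remove[of "arcs G" e] algebra_simps)
  qed
  have \<psi>_Ints: "\<psi> z \<in> \<int>" if "z \<notin> drawing (arcs G)" "z \<notin> path_image c" for z
  proof -
    have "z \<notin> path_image (curve e +++ c)"
      using that c e by (auto simp: path_image_join curve_finish drawing_def)
    then have "winding_number (curve e +++ c) z \<in> \<int>"
      using loop integer_winding_number by blast
    then show ?thesis using winding_sum_Ints[OF x that(1)] by (simp add: \<psi>_eq that)
  qed
  \<comment> \<open>None of the paths in \<open>\<psi>\<close> passes through \<open>p\<close>, so \<open>\<psi>\<close> does not jump there.\<close>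
  have "isCont \<psi> p"
    unfolding \<psi>_def using c interior_not_other_arc[OF e, of _ "1/2"]
    by (intro continuous_intros continuous_at_winding_number path_curve) (auto simp: p_def)
  then obtain \<delta> where "\<delta> > 0" and \<delta>: "\<And>z. dist z p < \<delta> \<Longrightarrow> dist (\<psi> z) (\<psi> p) < 1/2"
    unfolding continuous_at_eps_delta by (metis half_gt_zero zero_less_one)
  have "open (- path_image c)" using c by (simp add: closed_path_image open_Compl)
  moreover have "p \<in> - path_image c" using c by auto
  ultimately obtain \<eta> where "\<eta> > 0" and \<eta>: "ball p \<eta> \<subseteq> - path_image c"
    using open_contains_ball by metis
  have "p = curve e (1/2)" "1/2 \<in> {0<..<(1::real)}" "curve e (1/2) \<notin> path_image c"
    "pathstart c = pathfinish (curve e)" "pathfinish c = pathstart (curve e)" "min \<delta> \<eta> > 0"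
    using c e \<open>\<delta> > 0\<close> \<open>\<eta> > 0\<close> by (auto simp: p_def curve_start curve_finish)
  then obtain a' b' where ab: "a' \<in> L" "b' \<in> R" "a' \<in> ball p (min \<delta> \<eta>)" "b' \<in> ball p (min \<delta> \<eta>)"
    and w: "winding_number (curve e +++ c) a' = winding_number (curve e +++ c) b' + 1"
    using LR[unfolded left_right_def, rule_format, of "1/2" c "min \<delta> \<eta>"] c(1) by auto
  have off: "a' \<notin> drawing (arcs G)" "b' \<notin> drawing (arcs G)" "a' \<notin> path_image c" "b' \<notin> path_image c"
    using ab \<eta> L R in_components_subset by (fastforce simp: faces_drawing)+
  have "\<psi> a' = \<psi> b'"
  proof (rule ccontr)
    assume "\<psi> a' \<noteq> \<psi> b'"
    then have "1 \<le> dist (\<psi> a') (\<psi> b')"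
      using \<psi>_Ints off by (simp add: dist_norm cmod_diff_Ints_ge_1)
    moreover have "dist (\<psi> a') (\<psi> p) < 1/2" "dist (\<psi> b') (\<psi> p) < 1/2"
      using ab \<delta>[of a'] \<delta>[of b'] by (auto simp: dist_commute)
    ultimately show False by (smt (verit) dist_triangle2 field_sum_of_halves)
  qed
  then have "winding_sum x a' - winding_sum x b' = of_int (x e)"
    using \<psi>_eq off w by (simp add: algebra_simps)
  moreover have "winding_sum x a = winding_sum x a'" "winding_sum x b = winding_sum x b'"
    using winding_sum_constant_on_face[OF x L] winding_sum_constant_on_face[OF x R] ab assms
    by (metis constant_on_def)+
  ultimately show ?thesis by simp
qed

lemma circulation_imp_dual_coboundary:
  assumes dual: "is_dual_digraph G pos curve face H" and x: "circulation G x"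
  shows "\<exists>\<phi> :: 'f \<Rightarrow> int. \<forall>e\<in>arcs G. \<phi> (head H e) - \<phi> (tail H e) = x e"
proof -
  have face: "face i \<in> faces G pos curve" if "i \<in> verts H" for i
    using dual that by (auto simp: is_dual_digraph_def bij_betw_def)
  define pt where "pt i = (SOME z. z \<in> face i)" for i
  have pt: "pt i \<in> face i" if "i \<in> verts H" for i
    unfolding pt_def using in_components_nonempty[of "face i"] face[OF that]
    by (auto simp: faces_drawing some_in_eq)
  have "winding_sum x (pt i) \<in> \<int>" if "i \<in> verts H" for i
    using winding_sum_Ints[OF x] pt[OF that] face[OF that] in_components_subset
    by (fastforce simp: faces_drawing)
  then obtain \<phi> :: "'f \<Rightarrow> int" where \<phi>: "\<And>i. i \<in> verts H \<Longrightarrow> winding_sum x (pt i) = of_int (\<phi> i)"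
    unfolding Ints_def by (auto simp: image_iff) metis
  have "\<phi> (head H e) - \<phi> (tail H e) = x e" if e: "e \<in> arcs G" for e
  proof -
    have hd: "head H e \<in> verts H" "tail H e \<in> verts H"
      and "left_right (curve e) (face (head H e)) (face (tail H e))"
      using dual e by (auto simp: is_dual_digraph_def)
    from winding_sum_jump[OF x e this(3) face face pt pt]
    have "winding_sum x (pt (head H e)) - winding_sum x (pt (tail H e)) = of_int (x e)"
      using hd by blast
    then have "of_int (\<phi> (head H e) - \<phi> (tail H e)) = (of_int (x e) :: complex)"
      using hd by (simp add: \<phi>)
    then show ?thesis unfolding of_int_eq_iff .
  qed
  then show ?thesis by blast
qed

lemma path_connected_grown:
  assumes "grown G r R A"
  shows "path_connected (pos ` R \<union> (\<Union>e\<in>A. path_image (curve e)))"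
  using assms
proof (induction rule: grown.induct)
  case (step R A e)
  let ?X = "pos ` R \<union> (\<Union>e\<in>A. path_image (curve e))"
  have "pos ` (insert (head G e) R) \<union> (\<Union>e\<in>insert e A. path_image (curve e))
      = ?X \<union> path_image (curve e)"
    using path_image_curve[OF step(2)] step by auto
  moreover have "pos (tail G e) \<in> ?X \<inter> path_image (curve e)"
    using path_image_curve[OF step(2)] step by auto
  ultimately show ?case
    using path_connected_Un[OF step.IH, of "path_image (curve e)"] path_curve[OF step(2)]
    by (metis empty_iff path_connected_path_image)
qed auto

lemma path_connected_drawing:
  assumes "grown G r (verts G) A" "A \<subseteq> B" "B \<subseteq> arcs G"
  shows "path_connected (drawing B)"
proof -
  have "finite B" using assms(3) finite_arcs finite_subset by blast
  have "path_connected (drawing (A \<union> C))" if "C \<subseteq> arcs G" "finite C" for C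
    using that(2,1)
  proof (induction C rule: finite_induct)
    case empty
    then show ?case using path_connected_grown[OF assms(1)] by (simp add: drawing_def)
  next
    case (insert e C)
    have "drawing (A \<union> insert e C) = drawing (A \<union> C) \<union> path_image (curve e)"
      by (auto simp: drawing_def)
    moreover have "pos (tail G e) \<in> drawing (A \<union> C) \<inter> path_image (curve e)"
      using insert.prems by (auto simp: drawing_def path_image_curve)
    ultimately show ?case
      using path_connected_Un[OF insert.IH, of "path_image (curve e)"] insert.prems path_curve
      by (metis empty_iff insert_subset path_connected_path_image)
  qed
  from this[OF assms(3) \<open>finite B\<close>] show ?thesis using assms(2) by (simp add: Un_absorb1)
qed

text \<open>
  A new arc is attached to the tree at a single point, so Janiszewski's theorem applies at each step
  of the growth.
\<close>
lemma connected_complement_grown: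
  assumes "grown G r R A" "r \<in> verts G"
  shows "Topological_Spaces.connected (- (pos ` R \<union> (\<Union>e\<in>A. path_image (curve e))))"
  using assms(1)
proof (induction rule: grown.induct)
  case root
  show ?case using connected_punctured_universe[where 'N=complex] by simp
next
  case (step R A e)
  let ?X = "pos ` R \<union> (\<Union>e\<in>A. path_image (curve e))"
  have R: "R \<subseteq> verts G" using grown_verts[OF step(1) assms(2)] .
  have new: "pos ` (insert (head G e) R) \<union> (\<Union>e\<in>insert e A. path_image (curve e))
      = ?X \<union> path_image (curve e)"
    using path_image_curve[OF step(2)] step by auto
  have "pos (tail G e) \<noteq> pos (head G e)"
    using inj_pos step(2-4) by (metis head_in_verts inj_onD tail_in_verts)
  then have arc: "Path_Connected.arc (curve e)"
    using simple_curve[OF step(2)] curve_start[OF step(2)] curve_finish[OF step(2)]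
    by (metis arc_simple_path)
  have notA: "e \<notin> A" using grown_facts(7)[OF step(1)] step by blast
  have hd: "pos (head G e) \<notin> ?X"
  proof
    assume "pos (head G e) \<in> ?X"
    then consider "pos (head G e) \<in> pos ` R" | f where "f \<in> A" "pos (head G e) \<in> path_image (curve f)"
      by blast
    then show False
    proof cases
      case 1
      then obtain v where "v \<in> R" "pos (head G e) = pos v" by blast
      then show ?thesis using inj_onD[OF inj_pos, of "head G e" v] R step(2,4) by auto
    next
      case 2
      have f: "f \<in> arcs G" using 2 grown_facts(2)[OF step(1)] by blast
      then have "pos (head G e) \<in> {pos (tail G f), pos (head G f)}"
        using 2 interior_not_vertex[OF f _ head_in_verts[OF step(2)]]
        by (force simp: path_image_curve[OF f])
      then show ?thesis
        using inj_onD[OF inj_pos, of "head G e" "tail G f"] inj_onD[OF inj_pos, of "head G e" "head G f"]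
          step(2,4) f grown_facts(6,7)[OF step(1) 2(1)]
        by auto
    qed
  qed
  have "?X \<inter> path_image (curve e) = {pos (tail G e)}"
  proof -
    have "z \<notin> ?X" if "z \<in> curve e ` {0<..<1}" for z
    proof -
      obtain t where t: "t \<in> {0<..<1}" "z = curve e t" using \<open>z \<in> _\<close> by blast
      have "z \<notin> path_image (curve f)" if "f \<in> A" for f
        using interior_not_other_arc[OF step(2) _ _ t(1), of f] that t notA
          grown_facts(2)[OF step(1)] by auto
      moreover have "z \<notin> pos ` R" using interior_not_vertex[OF step(2) t(1)] t R by auto
      ultimately show ?thesis by blast
    qed
    then show ?thesis using hd step(3) by (auto simp: path_image_curve[OF step(2)])
  qed
  then have int: "Topological_Spaces.connected (?X \<inter> path_image (curve e))" by simp
  have X: "compact ?X" using compact_curves grown_facts(2,3)[OF step(1)] by blast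
  have cl: "closed (path_image (curve e))" by (simp add: closed_path_image path_curve step)
  have compl: "Topological_Spaces.connected (- path_image (curve e))"
    by (rule connected_arc_complement[OF arc]) simp
  have "connected_component (- (?X \<union> path_image (curve e))) a b"
    if ab: "a \<in> - (?X \<union> path_image (curve e))" "b \<in> - (?X \<union> path_image (curve e))" for a b
  proof (rule Janiszewski[OF X cl int])
    show "connected_component (- ?X) a b"
      using step.IH ab unfolding connected_iff_connected_component by blast
    show "connected_component (- path_image (curve e)) a b"
      using compl ab unfolding connected_iff_connected_component by blast
  qed
  then show ?case unfolding new connected_iff_connected_component by blast
qed

text \<open>
  Close \<open>e\<close> up to a Jordan curve \<open>J\<close> by a path in the rest \<open>K\<close> of the drawing. Two points near the
  interior of \<open>e\<close> that lie on the same side of \<open>J\<close> are separated neither by \<open>J\<close> nor by \<open>K\<close>. As \<open>K\<close>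
  meets \<open>J\<close> in the closing path, which is connected, Janiszewski's theorem puts
  them into the same face. Since \<open>L\<close> and \<open>R\<close> come with different winding numbers, they are the faces
  on the two sides of \<open>J\<close>.
\<close>
lemma arc_has_two_sides:
  assumes e: "e \<in> arcs G" and conn: "path_connected (drawing (arcs G - {e}))"
    and LR: "left_right (curve e) L R"
    and L: "L \<in> faces G pos curve" and R: "R \<in> faces G pos curve" and t: "t \<in> {0<..<1}"
  shows "\<exists>\<epsilon>>0. ball (curve e t) \<epsilon> \<inter> drawing (arcs G - {e}) = {} \<and>
    ball (curve e t) \<epsilon> \<subseteq> path_image (curve e) \<union> L \<union> R"
proof -
  define K where "K = drawing (arcs G - {e})"
  define p where "p = curve e t"
  let ?g = "curve e" and ?s = "pos (tail G e)" and ?f = "pos (head G e)"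
  have K: "compact K" unfolding K_def by (rule compact_drawing) auto
  have sf: "?s \<in> K" "?f \<in> K" using e by (auto simp: K_def drawing_def)
  have gK: "path_image ?g \<inter> K = {?s, ?f}"
  proof -
    have "z \<notin> K" if "z \<in> ?g ` {0<..<1}" for z
      using that interior_not_other_arc[OF e] interior_not_vertex[OF e]
      by (fastforce simp: K_def drawing_def)
    then show ?thesis using sf by (auto simp: path_image_curve[OF e])
  qed
  have pK: "p \<notin> K"
    using interior_not_other_arc[OF e _ _ t] interior_not_vertex[OF e t]
    by (fastforce simp: K_def drawing_def p_def)
  obtain c \<gamma> where c: "path c" "path_image c \<subseteq> K" "pathstart c = ?f" "pathfinish c = ?s"
    and \<gamma>: "simple_path \<gamma>" "pathfinish \<gamma> = pathstart \<gamma>" "path_image \<gamma> = path_image ?g \<union> path_image c"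
  proof (cases "?s = ?f")
    case True
    show ?thesis
    proof (rule that[of "linepath ?s ?s" ?g])
      show "path_image ?g = path_image ?g \<union> path_image (linepath ?s ?s)"
        using e by (auto simp: path_image_curve)
      show "simple_path ?g" by (rule simple_curve[OF e])
      show "path_image (linepath ?s ?s) \<subseteq> K" using sf by simp
    qed (simp_all add: True e curve_start curve_finish)
  next
    case False
    then obtain c where c: "Path_Connected.arc c" "path_image c \<subseteq> K" "pathstart c = ?f" "pathfinish c = ?s"
      using conn sf unfolding K_def path_connected_arcwise by metis
    have "Path_Connected.arc ?g" using False simple_curve[OF e] curve_start[OF e] curve_finish[OF e]
      by (metis arc_simple_path)
    then have "simple_path (?g +++ c)"
      using c gK e by (intro simple_path_join_loop) (auto simp: curve_start curve_finish)
    then show ?thesis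
      using that[of c "?g +++ c"] c e
      by (simp add: arc_imp_path path_image_join curve_start curve_finish)
  qed
  define J where "J = path_image \<gamma>"
  have "?s \<in> path_image c" "?f \<in> path_image c"
    using c pathstart_in_path_image[of c] pathfinish_in_path_image[of c] by simp_all
  then have "path_image ?g \<inter> K \<subseteq> path_image c" using gK by simp
  then have KJ: "K \<inter> J = path_image c"
    using c(2) unfolding J_def \<gamma>(3) by blast
  have D: "drawing (arcs G) = K \<union> J"
    using c e by (auto simp: J_def \<gamma>(3) K_def drawing_def)
  have "open (- K)" using K by (simp add: compact_imp_closed open_Compl)
  then obtain \<epsilon> where "\<epsilon> > 0" and \<epsilon>: "ball p \<epsilon> \<subseteq> - K"
    using pK open_contains_ball by (metis ComplI)
  have loop: "path (?g +++ c)" "pathfinish (?g +++ c) = pathstart (?g +++ c)"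
    "path_image (?g +++ c) = J"
    using c e by (auto simp: path_curve curve_start curve_finish path_image_join J_def \<gamma>(3))
  obtain a b where ab: "a \<in> L" "b \<in> R" "a \<in> ball p \<epsilon>" "b \<in> ball p \<epsilon>"
    and w: "winding_number (?g +++ c) a = winding_number (?g +++ c) b + 1"
  proof -
    have "path c \<and> pathstart c = pathfinish ?g \<and> pathfinish c = pathstart ?g \<and> ?g t \<notin> path_image c"
      using c pK e by (auto simp: p_def curve_start curve_finish)
    from LR[unfolded left_right_def, rule_format, OF t this \<open>\<epsilon> > 0\<close>]
    show ?thesis using that unfolding p_def by blast
  qed
  have off: "a \<notin> J" "b \<notin> J" using ab L R in_components_subset D by (fastforce simp: faces_drawing)+
  have jordan: "Topological_Spaces.connected (inside J)" "Topological_Spaces.connected (outside J)" "inside J \<union> outside J = - J"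
    using Jordan_inside_outside[OF \<gamma>(1,2)] by (auto simp: J_def)
  \<comment> \<open>The winding numbers tell that the closed curve separates \<open>a\<close> from \<open>b\<close>.\<close>
  have sep: "\<not> (a \<in> S \<and> b \<in> S)" if "Topological_Spaces.connected S" "S \<subseteq> - J" for S
    using winding_number_eq[OF loop(1,2), of a S b] w that loop(3) by auto
  have join: "z \<in> F" if F: "F \<in> faces G pos curve" "d \<in> F" "d \<in> ball p \<epsilon>"
    and z: "z \<in> ball p \<epsilon>" and S: "Topological_Spaces.connected S" "S \<subseteq> - J" "z \<in> S" "d \<in> S" for F d z S
  proof -
    have "connected_component (- K) d z"
      unfolding connected_component_def using \<epsilon> F z connected_ball by blast
    moreover have "connected_component (- J) d z"
      unfolding connected_component_def using S by blast
    moreover have "Topological_Spaces.connected (K \<inter> J)" unfolding KJ using c by (simp add: connected_path_image)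
    moreover have "closed J" using \<gamma>(1) by (simp add: J_def closed_simple_path_image)
    ultimately have "connected_component (- drawing (arcs G)) d z"
      using K Janiszewski unfolding D by blast
    moreover have "F = connected_component_set (- drawing (arcs G)) d"
      using F by (metis components_iff connected_component_eq faces_drawing)
    ultimately show ?thesis by simp
  qed
  have "z \<in> L \<union> R" if "z \<in> ball p \<epsilon>" "z \<notin> path_image ?g" for z
  proof -
    have "z \<notin> J" using that \<epsilon> c unfolding J_def \<gamma>(3) by auto
    then have "z \<in> inside J \<union> outside J" "a \<in> inside J \<union> outside J" "b \<in> inside J \<union> outside J"
      unfolding jordan(3) using off by simp_all
    moreover have io: "inside J \<subseteq> - J" "outside J \<subseteq> - J" using jordan(3) by blast+
    moreover note sep[OF jordan(1) io(1)] sep[OF jordan(2) io(2)]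
    ultimately consider "z \<in> inside J" "a \<in> inside J" | "z \<in> outside J" "a \<in> outside J"
      | "z \<in> inside J" "b \<in> inside J" | "z \<in> outside J" "b \<in> outside J"
      by blast
    then show ?thesis
      using join[OF L ab(1,3) that(1)] join[OF R ab(2,4) that(1)] jordan(1,2) io
      by cases (metis UnI1 UnI2)+
  qed
  then show ?thesis using \<open>\<epsilon> > 0\<close> \<epsilon> unfolding K_def p_def by blast
qed

text \<open>
  The deletion of the tree leaves a connected part of the plane. Carry \<open>\<psi>\<close> over to it, with the
  value on an open arc taken from the two faces along it, where the values agree. The result is locally constant:
  near an arc there are only these two faces.
\<close>
lemma dual_connected_off_tree:
  assumes dual: "is_dual_digraph G pos curve face H" and A: "grown G r (verts G) A"
    and \<psi>: "\<And>e. e \<in> arcs G - A \<Longrightarrow> \<psi> (head H e) = \<psi> (tail H e)"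
    and ij: "i \<in> verts H" "j \<in> verts H"
  shows "\<psi> i = \<psi> j"
proof -
  define X where "X = drawing A"
  define P where "P z c \<longleftrightarrow> (\<exists>i\<in>verts H. z \<in> face i \<and> c = \<psi> i) \<or>
    (\<exists>e\<in>arcs G - A. z \<in> curve e ` {0<..<1} \<and> c = \<psi> (head H e))" for z c
  have AG: "A \<subseteq> arcs G" using grown_facts(2)[OF A] .
  have bij: "bij_betw face (verts H) (faces G pos curve)"
    and HG: "\<And>e. e \<in> arcs G \<Longrightarrow> head H e \<in> verts H" "\<And>e. e \<in> arcs G \<Longrightarrow> tail H e \<in> verts H"
      "\<And>e. e \<in> arcs G \<Longrightarrow> left_right (curve e) (face (head H e)) (face (tail H e))"
    using dual by (auto simp: is_dual_digraph_def)
  have face: "face i \<in> faces G pos curve" if "i \<in> verts H" for i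
    using bij that by (auto simp: bij_betw_def)
  have face_sub: "face i \<subseteq> - drawing (arcs G)" if "i \<in> verts H" for i
    using face[OF that] in_components_subset by (auto simp: faces_drawing)
  have face_unique: "i = j" if "i \<in> verts H" "j \<in> verts H" "z \<in> face i" "z \<in> face j" for i j z
  proof -
    have "face i = face j"
      using face that components_nonoverlap by (fastforce simp: faces_drawing)
    then show ?thesis using bij that by (auto simp: bij_betw_def inj_on_def)
  qed
  have not_face: "z \<notin> face i"
    if "e \<in> arcs G" "z \<in> curve e ` {0<..<1}" "i \<in> verts H" for e z i
  proof -
    have "z \<in> drawing (arcs G)" using that(1,2) by (auto simp: drawing_def path_image_curve)
    then show ?thesis using face_sub[OF that(3)] by blast
  qed
  have at_face: "c = \<psi> i" if "P z c" "i \<in> verts H" "z \<in> face i" for z c i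
    using that(1) unfolding P_def
  proof (elim disjE bexE conjE)
    fix j assume "j \<in> verts H" "z \<in> face j" "c = \<psi> j"
    then show ?thesis using face_unique[of i j z] that by simp
  next
    fix e assume "e \<in> arcs G - A" "z \<in> curve e ` {0<..<1}"
    then show ?thesis using not_face[of e z i] that by simp
  qed
  have at_arc: "c = \<psi> (head H e)" if "P z c" "e \<in> arcs G" "z \<in> curve e ` {0<..<1}" for z c e
    using that(1) unfolding P_def
  proof (elim disjE bexE conjE)
    fix j assume "j \<in> verts H" "z \<in> face j"
    then show ?thesis using not_face[of e z j] that by simp
  next
    fix f assume f: "f \<in> arcs G - A" "z \<in> curve f ` {0<..<1}" "c = \<psi> (head H f)"
    then have "e = f" using no_crossing[of e f] that by blast
    then show ?thesis using f by simp
  qed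
  have unique: "c = c'" if "P z c" "P z c'" for z c c'
    using that(1) unfolding P_def
  proof (elim disjE bexE conjE)
    fix i assume "i \<in> verts H" "z \<in> face i" "c = \<psi> i"
    then show ?thesis using at_face[OF that(2), of i] by simp
  next
    fix e assume "e \<in> arcs G - A" "z \<in> curve e ` {0<..<1}" "c = \<psi> (head H e)"
    then show ?thesis using at_arc[OF that(2), of e] by simp
  qed
  have local: "\<exists>\<epsilon>>0. \<exists>c. \<forall>w\<in>ball z \<epsilon>. P w c" if "z \<in> - X" for z
  proof (cases "z \<in> drawing (arcs G)")
    case False
    then have "connected_component_set (- drawing (arcs G)) z \<in> faces G pos curve"
      by (auto simp: faces_drawing components_def)
    moreover have "z \<in> connected_component_set (- drawing (arcs G)) z" using False by simp
    ultimately obtain i where i: "i \<in> verts H" "z \<in> face i"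
      using bij by (metis bij_betw_imp_surj_on imageE)
    have "open (face i)"
      using face[OF i(1)] compact_drawing[of "arcs G"]
      by (metis compact_imp_closed faces_drawing open_Compl open_components order_refl)
    then show ?thesis using i unfolding P_def by (metis open_contains_ball subsetD)
  next
    case True
    have "z \<notin> pos ` verts G" using that by (auto simp: X_def drawing_def)
    moreover from this True obtain e where "e \<in> arcs G" "z \<in> path_image (curve e)"
      by (auto simp: drawing_def)
    moreover from this that have "e \<notin> A" by (auto simp: X_def drawing_def)
    ultimately have e: "e \<in> arcs G - A" "z \<in> curve e ` {0<..<1}"
      by (auto simp: path_image_curve)
    then obtain t where t: "t \<in> {0<..<1}" "z = curve e t" by blast
    have eG: "e \<in> arcs G" using e by simp
    have "path_connected (drawing (arcs G - {e}))"
      using e AG by (intro path_connected_drawing[OF A]) auto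
    from arc_has_two_sides[OF eG this HG(3)[OF eG] face[OF HG(1)[OF eG]] face[OF HG(2)[OF eG]] t(1)]
    obtain \<epsilon> where "\<epsilon> > 0" and \<epsilon>: "ball z \<epsilon> \<inter> drawing (arcs G - {e}) = {}"
      "ball z \<epsilon> \<subseteq> path_image (curve e) \<union> face (head H e) \<union> face (tail H e)"
      unfolding t(2) by blast
    have "P w (\<psi> (head H e))" if w: "w \<in> ball z \<epsilon>" for w
    proof -
      have "w \<notin> pos ` verts G" using \<epsilon>(1) w by (auto simp: drawing_def)
      then have "w \<in> curve e ` {0<..<1} \<or> w \<in> face (head H e) \<or> w \<in> face (tail H e)"
        using \<epsilon>(2) w eG by (auto simp: path_image_curve)
      then show ?thesis unfolding P_def using e(1) HG[OF eG] \<psi>[OF e(1)] by auto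
    qed
    then show ?thesis using \<open>\<epsilon> > 0\<close> by blast
  qed
  define u where "u z = (SOME c. P z c)" for z
  have u: "u z = c" if "P z c" for z c using that unique unfolding u_def by (metis someI)
  have "Topological_Spaces.connected (- X)"
    using connected_complement_grown[OF A grown_facts(1)[OF A]] by (simp add: X_def drawing_def)
  moreover have "\<forall>z\<in>- X. eventually (\<lambda>w. u z = u w) (at z within - X)"
  proof
    fix z assume "z \<in> - X"
    from local[OF this] obtain \<epsilon> c where "\<epsilon> > 0" "\<And>w. w \<in> ball z \<epsilon> \<Longrightarrow> P w c" by blast
    then have "u z = u w" if "dist w z < \<epsilon>" for w
      using that u by (metis centre_in_ball dist_commute mem_ball)
    then show "eventually (\<lambda>w. u z = u w) (at z within - X)"
      using \<open>\<epsilon> > 0\<close> unfolding eventually_at by blast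
  qed
  moreover have "face i \<noteq> {}" "face j \<noteq> {}"
    using face ij in_components_nonempty unfolding faces_drawing by blast+
  then obtain zi zj where z: "zi \<in> face i" "zj \<in> face j" by blast
  moreover have "X \<subseteq> drawing (arcs G)" using AG by (auto simp: X_def drawing_def)
  then have "zi \<in> - X" "zj \<in> - X" using z face_sub[OF ij(1)] face_sub[OF ij(2)] by blast+
  ultimately have "u zi = u zj" using connected_local_const[of "- X" zi zj u] by blast
  moreover have "P zi (\<psi> i)" "P zj (\<psi> j)" using z ij unfolding P_def by blast+
  ultimately show ?thesis using u by metis
qed

lemma dual_coboundary_circulation:
  fixes \<phi> :: "'f \<Rightarrow> int"
  assumes dual: "is_dual_digraph G pos curve face H" and A: "grown G r (verts G) A"
  shows "circulation G (\<lambda>e. \<phi> (head H e) - \<phi> (tail H e))"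
proof -
  obtain x where x: "circulation G x" "\<And>e. e \<notin> A \<Longrightarrow> x e = \<phi> (head H e) - \<phi> (tail H e)"
    using circulation_extending[OF A, of "\<lambda>e. \<phi> (head H e) - \<phi> (tail H e)"] by blast
  obtain \<phi>' where \<phi>': "\<And>e. e \<in> arcs G \<Longrightarrow> \<phi>' (head H e) - \<phi>' (tail H e) = x e"
    using circulation_imp_dual_coboundary[OF dual x(1)] by metis
  have const: "\<phi> i - \<phi>' i = \<phi> j - \<phi>' j" if "i \<in> verts H" "j \<in> verts H" for i j
    using x(2) \<phi>' by (intro dual_connected_off_tree[OF dual A _ that]) force
  have "\<phi> (head H e) - \<phi> (tail H e) = x e" if "e \<in> arcs G" for e
    using const[of "head H e" "tail H e"] \<phi>'[OF that] dual that by (auto simp: is_dual_digraph_def)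
  then show ?thesis using x(1) unfolding circulation_def
    by (metis (no_types, lifting) in_in_arcs_conv in_out_arcs_conv sum.cong)
qed

end

section \<open>Evaluating greedoid polynomials\<close>

lemma poly_of_int_mult:
  "map_poly of_int (p * q) = (map_poly of_int p * map_poly of_int q :: 'a::comm_ring_1 poly)"
  by (rule poly_eqI) (simp add: coeff_map_poly coeff_mult)

lemma poly_of_int_power:
  "map_poly of_int (p ^ k) = (map_poly of_int p ^ k :: 'a::comm_ring_1 poly)"
  by (induction k) (simp_all add: poly_of_int_mult)

lemma poly_of_int_sum:
  "map_poly of_int (sum f A) = (\<Sum>a\<in>A. map_poly of_int (f a) :: 'a::comm_ring_1 poly)"
  by (rule poly_eqI) (simp add: coeff_map_poly coeff_sum)

lemma pcompose_monom_1: "pcompose (monom 1 k) p = (p ^ k :: 'a::comm_ring_1 poly)"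
  by (induction k) (simp_all add: monom_Suc pcompose_pCons monom_0)

text \<open>
  The \<open>h\<close>-vector is defined by shifting the argument of the \<open>f\<close>-polynomial by one, and the greedoid
  polynomial has the entries of the \<open>h\<close>-vector as its coefficients in that same order, so it is
  the shifted \<open>f\<close>-polynomial itself. The facets \<open>S - B\<close> supply the dimension.
\<close>
lemma poly_greedoid_polynomial:
  assumes S: "finite S" and sub: "\<And>B. B \<in> greedoid_bases A \<Longrightarrow> B \<subseteq> S"
    and card: "\<And>B. B \<in> greedoid_bases A \<Longrightarrow> card B = r" and B0: "B0 \<in> greedoid_bases A"
  shows "poly (greedoid_polynomial S A) t = (\<Sum>F\<in>dual_complex S A. (t - 1) ^ (card S - r - card F))"
proof -
  define \<Delta> n where "\<Delta> = dual_complex S A" and "n = card S - r"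
  have rank: "greedoid_rank A = r" unfolding greedoid_rank_def using card B0 by (intro the_equality) auto
  have \<Delta>_sub: "F \<subseteq> S" if "F \<in> \<Delta>" for F using that by (auto simp: \<Delta>_def dual_complex_def)
  have fin: "finite \<Delta>" using \<Delta>_sub S by (intro finite_subset[of \<Delta> "Pow S"]) auto
  have compl: "card (S - B) = n" if "B \<in> greedoid_bases A" for B
    using card_Diff_subset[OF finite_subset[OF sub[OF that] S] sub[OF that]] card[OF that]
    by (simp add: n_def)
  have card_le: "card F \<le> n" if F: "F \<in> \<Delta>" for F
  proof -
    obtain B where B: "B \<in> greedoid_bases A" "F \<subseteq> S - B" using F by (auto simp: \<Delta>_def dual_complex_def)
    then have "card F \<le> card (S - B)" using S by (intro card_mono) auto
    also have "\<dots> = n" using B(1) by (rule compl)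
    finally show ?thesis .
  qed
  have "S - B0 \<in> \<Delta>" using B0 by (auto simp: \<Delta>_def dual_complex_def)
  moreover have "card (S - B0) = n" using B0 by (rule compl)
  ultimately have dim: "dim_plus_1 \<Delta> = n"
    unfolding dim_plus_1_def using fin card_le by (intro Max_eqI) auto
  have empty: "{} \<in> \<Delta>" using B0 by (auto simp: \<Delta>_def dual_complex_def)
  have f: "f_polynomial \<Delta> = (\<Sum>F\<in>\<Delta>. monom 1 (n - card F))"
    unfolding f_polynomial_def dim using sum.remove[OF fin empty, of "\<lambda>F. monom (1 :: int) (n - card F)"] by simp
  define q where "q = pcompose (f_polynomial \<Delta>) [:-1, 1:]"
  have q: "q = (\<Sum>F\<in>\<Delta>. [:-1, 1:] ^ (n - card F))"
    by (simp add: q_def f pcompose_sum pcompose_monom_1)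
  have "degree q \<le> n"
  proof -
    have "degree (f_polynomial \<Delta>) \<le> n"
      unfolding f by (intro degree_sum_le fin) (simp add: degree_monom_eq)
    then show ?thesis unfolding q_def by (simp add: degree_pcompose)
  qed
  then have deg: "degree (map_poly of_int q :: real poly) \<le> n"
    using map_poly_degree_leq[of "of_int :: int \<Rightarrow> real" q] by simp
  have "greedoid_polynomial S A = (\<Sum>i\<le>n. monom (of_int (coeff q (n - i))) (n - i))"
    unfolding greedoid_polynomial_def Let_def rank h_vector_def
    by (simp add: dim n_def[symmetric] \<Delta>_def[symmetric] q_def[symmetric])
  also have "\<dots> = (\<Sum>j\<le>n. monom (coeff (map_poly of_int q) j) j)"
    by (rule sum.reindex_bij_witness[of _ "\<lambda>j. n - j" "\<lambda>i. n - i"]) (auto simp: coeff_map_poly)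
  also have "\<dots> = map_poly of_int q" by (rule poly_as_sum_of_monoms'[OF deg])
  also have "poly \<dots> t = (\<Sum>F\<in>\<Delta>. (t - 1) ^ (n - card F))"
    by (simp add: q poly_of_int_sum poly_of_int_power poly_sum poly_power map_poly_pCons)
  finally show ?thesis by (simp add: \<Delta>_def n_def)
qed

section \<open>The branching greedoid\<close>

definition adjacent :: "('v, 'e) pre_digraph \<Rightarrow> 'e set \<Rightarrow> ('v \<times> 'v) set"
  where "adjacent G A = (\<Union>e\<in>A. {(tail G e, head G e), (head G e, tail G e)})"

lemma adjacent_mono: "A \<subseteq> B \<Longrightarrow> adjacent G A \<subseteq> adjacent G B"
  unfolding adjacent_def by blast

lemma adjacent_sym: "(u, v) \<in> (adjacent G A)\<^sup>* \<Longrightarrow> (v, u) \<in> (adjacent G A)\<^sup>*"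
  by (rule symD[OF sym_rtrancl]) (auto simp: sym_def adjacent_def)

lemma adjacent_arc: "e \<in> A \<Longrightarrow> (tail G e, head G e) \<in> (adjacent G A)\<^sup>*"
  by (rule r_into_rtrancl) (auto simp: adjacent_def)

lemma reachable_mk_symmetric:
  assumes "wf_digraph X"
  shows "u \<rightarrow>\<^sup>*\<^bsub>with_proj (mk_symmetric X)\<^esub> v \<longleftrightarrow> u \<in> verts X \<and> (u, v) \<in> (adjacent X (arcs X))\<^sup>*"
proof -
  interpret wf_digraph X by (rule assms)
  have ends: "arcs_ends (with_proj (mk_symmetric X)) = adjacent X (arcs X)"
    by (auto simp: arcs_ends_def arc_to_ends_def mk_symmetric_def adjacent_def)
  have verts: "verts (with_proj (mk_symmetric X)) = verts X" by (simp add: mk_symmetric_def)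
  have step: "v \<in> verts X" if "(u, v) \<in> adjacent X (arcs X)" for u v
    using that by (auto simp: adjacent_def)
  have "v \<in> verts X" if "u \<in> verts X" "(u, v) \<in> (adjacent X (arcs X))\<^sup>*"
    using that(2,1) step by (induction rule: rtrancl_induct) auto
  then show ?thesis
    unfolding reachable_def ends verts
    using rtrancl_on_rtranclI[of u v "verts X" "adjacent X (arcs X)"] in_rtrancl_on_in_F[of u v "verts X"]
      rtrancl_consistent_rtrancl_on[of u v "adjacent X (arcs X)" "verts X"] step
    by blast
qed

text \<open>
  Prepending an arc to a simple path either gives a simple path or meets it in one of its vertices; in
  the second case the part of the path from there on will do.
\<close>
lemma simple_undirected_path:
  assumes "(u, v) \<in> (adjacent G A)\<^sup>*"
  shows "\<exists>vs es. length vs = Suc (length es) \<and> distinct vs \<and> hd vs = u \<and> last vs = v \<and> set es \<subseteq> A \<and>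
    (\<forall>i<length es. {tail G (es ! i), head G (es ! i)} = {vs ! i, vs ! Suc i})"
  using assms
proof (induction rule: converse_rtrancl_induct)
  case base
  show ?case by (rule exI[of _ "[v]"], rule exI[of _ "[]"]) simp
next
  case (step u w)
  then obtain vs es where p: "length vs = Suc (length es)" "distinct vs" "hd vs = w" "last vs = v"
    "set es \<subseteq> A" "\<And>i. i < length es \<Longrightarrow> {tail G (es ! i), head G (es ! i)} = {vs ! i, vs ! Suc i}"
    by blast
  have vs0: "vs \<noteq> []" "vs ! 0 = w" using p(1,3) by (cases vs; simp)+
  show ?case
  proof (cases "u \<in> set vs")
    case True
    then obtain j where j: "j < length vs" "vs ! j = u" by (auto simp: in_set_conv_nth)
    show ?thesis
    proof (intro exI[of _ "drop j vs"] exI[of _ "drop j es"] conjI allI impI)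
      show "length (drop j vs) = Suc (length (drop j es))" using p(1) j by simp
      show "hd (drop j vs) = u" using j by (simp add: hd_drop_conv_nth)
      show "last (drop j vs) = v" using j p(4) by simp
      show "set (drop j es) \<subseteq> A" using p(5) set_drop_subset by fastforce
      fix i assume "i < length (drop j es)"
      then show "{tail G (drop j es ! i), head G (drop j es ! i)} = {drop j vs ! i, drop j vs ! Suc i}"
        using p(1) p(6)[of "j + i"] by simp
    qed (simp add: p(2))
  next
    case False
    obtain e where e: "e \<in> A" "{tail G e, head G e} = {u, w}"
      using step(1) by (auto simp: adjacent_def)
    show ?thesis
    proof (intro exI[of _ "u # vs"] exI[of _ "e # es"] conjI allI impI)
      fix i assume "i < length (e # es)"
      then show "{tail G ((e # es) ! i), head G ((e # es) ! i)} = {(u # vs) ! i, (u # vs) ! Suc i}"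
        using e(2) vs0(2) p(6)[of "i - 1"] by (cases i) simp_all
    qed (use False p e vs0 in simp_all)
  qed
qed

lemma arc_between_connected_closes_cycle:
  assumes e: "e \<in> arcs T" and conn: "(head T e, tail T e) \<in> (adjacent T (arcs T - {e}))\<^sup>*"
  shows "\<exists>vs es. undirected_cycle T vs es"
proof -
  obtain vs es where p: "length vs = Suc (length es)" "distinct vs" "hd vs = head T e" "last vs = tail T e"
    "set es \<subseteq> arcs T - {e}"
    "\<And>i. i < length es \<Longrightarrow> {tail T (es ! i), head T (es ! i)} = {vs ! i, vs ! Suc i}"
    using simple_undirected_path[OF conn] by blast
  have "distinct es"
    unfolding distinct_conv_nth
  proof (intro allI impI)
    fix i j assume ij: "i < length es" "j < length es" "i \<noteq> j"
    show "es ! i \<noteq> es ! j"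
    proof
      assume "es ! i = es ! j"
      then have "{vs ! i, vs ! Suc i} = {vs ! j, vs ! Suc j}" using p(6) ij by metis
      then have "(vs ! i = vs ! j \<or> vs ! i = vs ! Suc j) \<and> (vs ! j = vs ! i \<or> vs ! j = vs ! Suc i)"
        by blast
      moreover have "a = b" if "a \<le> length es" "b \<le> length es" "vs ! a = vs ! b" for a b
        using p(1,2) that nth_eq_iff_index_eq[of vs a b] by simp
      ultimately have "(i = j \<or> i = Suc j) \<and> (j = i \<or> j = Suc i)"
        using ij by (meson Suc_leI less_imp_le)
      then show False using ij(3) by presburger
    qed
  qed
  moreover have "{tail T ((es @ [e]) ! i), head T ((es @ [e]) ! i)}
      = {vs ! i, vs ! (Suc i mod length (es @ [e]))}" if i: "i < length (es @ [e])" for i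
  proof (cases "i < length es")
    case True
    then show ?thesis using p(6)[OF True] by (simp add: nth_append)
  next
    case False
    with i have "i = length es" by simp
    moreover have "vs \<noteq> []" using p(1) by auto
    then have "vs ! 0 = head T e" "vs ! length es = tail T e"
      using p(1,3,4) hd_conv_nth[of vs] last_conv_nth[of vs] by simp_all
    ultimately show ?thesis by (auto simp: nth_append)
  qed
  ultimately have "undirected_cycle T vs (es @ [e])"
    using p(1,2,5) e unfolding undirected_cycle_def by auto
  then show ?thesis by blast
qed

lemma grown_connected:
  assumes "grown G r R A" "v \<in> R"
  shows "(r, v) \<in> (adjacent G A)\<^sup>*"
  using assms
proof (induction arbitrary: v rule: grown.induct)
  case (step R A e)
  have mono: "(adjacent G A)\<^sup>* \<subseteq> (adjacent G (insert e A))\<^sup>*"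
    by (intro rtrancl_mono adjacent_mono) blast
  have "(r, tail G e) \<in> (adjacent G (insert e A))\<^sup>*" using step.IH[OF step(3)] mono by blast
  moreover have "(tail G e, head G e) \<in> (adjacent G (insert e A))\<^sup>*" by (rule adjacent_arc) simp
  ultimately have "(r, head G e) \<in> (adjacent G (insert e A))\<^sup>*" by (rule rtrancl_trans)
  then show ?case using step.prems step.IH[of v] mono by blast
qed auto

lemma grown_tail_connected:
  assumes "grown G r R A" "f \<in> A"
  shows "(r, tail G f) \<in> (adjacent G (A - {f}))\<^sup>*"
  using assms
proof (induction arbitrary: f rule: grown.induct)
  case (step R A e)
  have notA: "e \<notin> A" using grown_facts(7)[OF step(1)] step(4) by blast
  show ?case
  proof (cases "f = e")
    case True
    then show ?thesis using grown_connected[OF step(1,3)] notA by simp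
  next
    case False
    then have "(r, tail G f) \<in> (adjacent G (A - {f}))\<^sup>*" using step by blast
    moreover have "(adjacent G (A - {f}))\<^sup>* \<subseteq> (adjacent G (insert e A - {f}))\<^sup>*"
      by (intro rtrancl_mono adjacent_mono) blast
    ultimately show ?thesis by blast
  qed
qed simp

text \<open>
  A cycle cannot use the arc that was added last, as no other arc touches its head.
\<close>
lemma grown_acyclic:
  assumes "grown G r R A" "undirected_cycle G vs es"
  shows "\<not> set es \<subseteq> A"
  using assms(1)
proof (induction rule: grown.induct)
  case root
  show ?case using assms(2) by (auto simp: undirected_cycle_def)
next
  case (step R A e)
  show ?case
  proof
    assume sub: "set es \<subseteq> insert e A"
    let ?n = "length es" and ?h = "head G e"
    have cyc: "?n > 0" "distinct es" "length vs = ?n"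
      "\<And>i. i < ?n \<Longrightarrow> {tail G (es ! i), head G (es ! i)} = {vs ! i, vs ! (Suc i mod ?n)}"
      using assms(2) by (auto simp: undirected_cycle_def)
    have only_e: "es ! i = e" if "i < ?n" "?h \<in> {tail G (es ! i), head G (es ! i)}" for i
    proof (rule ccontr)
      assume "es ! i \<noteq> e"
      then have "es ! i \<in> A" using sub nth_mem[OF that(1)] by blast
      then show False using grown_facts(6,7)[OF step(1)] that(2) step(4) by auto
    qed
    have "e \<in> set es" using sub step.IH by blast
    then obtain i where i: "i < ?n" "es ! i = e" by (auto simp: in_set_conv_nth)
    have "?h \<in> {vs ! i, vs ! (Suc i mod ?n)}" using cyc(4)[OF i(1)] i(2) by auto
    moreover have "Suc i mod ?n < ?n" using cyc(1) by (rule mod_less_divisor)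
    ultimately obtain k where k: "k < ?n" "vs ! k = ?h" using i(1) by (metis insertE singletonD)
    define j where "j = (if k = 0 then ?n - 1 else k - 1)"
    have j: "j < ?n" "Suc j mod ?n = k" using k cyc(1) by (auto simp: j_def)
    \<comment> \<open>The two arcs of the cycle at the new leaf are both the new arc.\<close>
    have "es ! k = e" using cyc(4)[OF k(1)] k(2) by (intro only_e k(1)) auto
    moreover have "es ! j = e" using cyc(4)[OF j(1)] j(2) k(2) by (intro only_e j(1)) auto
    ultimately have "j = k" using nth_eq_iff_index_eq[OF cyc(2) j(1) k(1)] by simp
    then have "?n = 1" using k(1) unfolding j_def by presburger
    then have "{tail G e, ?h} = {vs ! 0}" using cyc(4)[of i] i by simp
    then have "tail G e = ?h" by auto
    then show False using step by simp
  qed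
qed

context fin_digraph
begin

lemma grown_arborescence:
  assumes gr: "grown G r R A" and r: "r \<in> verts G"
  shows "arborescence G r \<lparr>verts = R, arcs = A, tail = tail G, head = head G\<rparr>" (is "arborescence G r ?T")
proof -
  note facts = grown_facts[OF gr]
  have T: "wf_digraph ?T" using facts by unfold_locales auto
  have adj: "adjacent \<lparr>verts = S, arcs = B, tail = tail G, head = head G\<rparr> = adjacent G" for S B
    by (simp add: adjacent_def fun_eq_iff)
  have "subgraph ?T G"
    using facts(2) grown_verts[OF gr r] T wf_digraph_axioms
    by (auto simp: subgraph_def compatible_def)
  moreover have "undirected_tree ?T"
    unfolding undirected_tree_def
  proof
    have "u \<rightarrow>\<^sup>*\<^bsub>with_proj (mk_symmetric ?T)\<^esub> v" if "u \<in> R" "v \<in> R" for u v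
      using that rtrancl_trans[OF adjacent_sym[OF grown_connected[OF gr that(1)]] grown_connected[OF gr that(2)]]
      by (simp add: reachable_mk_symmetric[OF T] adj)
    then show "Digraph_Component.connected ?T"
      using facts(1) by (auto simp: Digraph_Component.connected_def strongly_connected_def mk_symmetric_def)
    show "\<nexists>vs es. undirected_cycle ?T vs es"
    proof
      assume "\<exists>vs es. undirected_cycle ?T vs es"
      then obtain vs es where "undirected_cycle ?T vs es" by blast
      then have "undirected_cycle G vs es" "set es \<subseteq> A"
        using facts(2) by (auto simp: undirected_cycle_def)
      then show False using grown_acyclic[OF gr] by blast
    qed
  qed
  moreover have "r \<rightarrow>\<^sup>*\<^bsub>with_proj (mk_symmetric (pre_digraph.del_arc ?T e))\<^esub> tail ?T e" if "e \<in> arcs ?T" for e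
  proof -
    have "wf_digraph (pre_digraph.del_arc ?T e)"
      using facts by unfold_locales (auto simp: pre_digraph.del_arc_def)
    moreover have "e \<in> A" using that by simp
    ultimately show ?thesis
      using grown_tail_connected[OF gr, of e] facts(1)
      by (simp add: reachable_mk_symmetric adj pre_digraph.del_arc_def)
  qed
  ultimately show ?thesis using facts(1) by (simp add: arborescence_def)
qed

lemma rtrancl_leaves:
  assumes "(u, v) \<in> S\<^sup>*" "u \<in> R" "v \<notin> R"
  shows "\<exists>a b. (a, b) \<in> S \<and> a \<in> R \<and> b \<notin> R"
  using assms by (induction rule: rtrancl_induct) auto

text \<open>
  Grow within \<open>T\<close> as long as possible. An arc of \<open>T\<close> that could only be added against its direction
  has its head connected with the root by what has been grown, and its tail connected with the
  root by the orientation of \<open>T\<close>, in both cases without that arc; it would therefore lie on a cycle. The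
  same holds for an arc left over once all vertices are reached.
\<close>
lemma arborescence_grown:
  assumes T: "arborescence G r T"
  shows "grown G r (verts T) (arcs T)"
proof -
  have sub: "verts T \<subseteq> verts G" "arcs T \<subseteq> arcs G" and wf: "wf_digraph T"
    and ends: "tail T = tail G" "head T = head G" and r: "r \<in> verts T"
    and conn: "Digraph_Component.connected T"
    and acyclic: "\<And>vs es. \<not> undirected_cycle T vs es"
    and away: "\<And>e. e \<in> arcs T \<Longrightarrow>
        r \<rightarrow>\<^sup>*\<^bsub>with_proj (mk_symmetric (pre_digraph.del_arc T e))\<^esub> tail T e"
    using T by (auto simp: arborescence_def subgraph_def compatible_def undirected_tree_def)
  interpret T: wf_digraph T by (rule wf)
  have adj: "adjacent T = adjacent G"
    "adjacent \<lparr>verts = S, arcs = B, tail = tail G, head = head G\<rparr> = adjacent G" for S B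
    using ends by (simp_all add: adjacent_def fun_eq_iff)
  have no_cycle: "(head G e, tail G e) \<notin> (adjacent G (arcs T - {e}))\<^sup>*" if "e \<in> arcs T" for e
    using arc_between_connected_closes_cycle[OF that] acyclic ends by (auto simp: adj)
  have away': "(r, tail G e) \<in> (adjacent G (arcs T - {e}))\<^sup>*" if e: "e \<in> arcs T" for e
  proof -
    have "wf_digraph (pre_digraph.del_arc T e)" by unfold_locales (auto simp: pre_digraph.del_arc_def)
    then show ?thesis
      using away[OF e] ends by (simp add: reachable_mk_symmetric adj pre_digraph.del_arc_def)
  qed
  have reach: "(r, v) \<in> (adjacent G (arcs T))\<^sup>*" if "v \<in> verts T" for v
  proof -
    have "r \<rightarrow>\<^sup>*\<^bsub>with_proj (mk_symmetric T)\<^esub> v"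
      using conn that r by (auto simp: Digraph_Component.connected_def strongly_connected_def mk_symmetric_def)
    then show ?thesis using ends by (simp add: reachable_mk_symmetric[OF wf] adj)
  qed
  have not_back: "(r, head G e) \<notin> (adjacent G (arcs T - {e}))\<^sup>*" if "e \<in> arcs T" for e
    using no_cycle[OF that] away'[OF that] adjacent_sym rtrancl_trans by metis
  have grow: "\<exists>A'. grown G r (verts T) A' \<and> A' \<subseteq> arcs T"
    if "grown G r R A" "A \<subseteq> arcs T" "R \<subseteq> verts T" for R A
    using that
  proof (induction "card (verts T - R)" arbitrary: R A rule: less_induct)
    case less
    show ?case
    proof (cases "R = verts T")
      case True
      with less.prems show ?thesis by auto
    next
      case False
      then obtain v where v: "v \<in> verts T" "v \<notin> R" using less.prems(3) by blast
      obtain a b where "(a, b) \<in> adjacent G (arcs T)" "a \<in> R" "b \<notin> R"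
        using rtrancl_leaves[OF reach[OF v(1)] grown_facts(1)[OF less.prems(1)] v(2)] by blast
      then obtain e where e: "e \<in> arcs T"
        "tail G e \<in> R \<and> head G e \<notin> R \<or> head G e \<in> R \<and> tail G e \<notin> R"
        by (auto simp: adjacent_def)
      have "\<not> (head G e \<in> R \<and> tail G e \<notin> R)"
      proof
        assume he: "head G e \<in> R \<and> tail G e \<notin> R"
        then have "e \<notin> A" using grown_facts(6)[OF less.prems(1)] by blast
        then have "(adjacent G A)\<^sup>* \<subseteq> (adjacent G (arcs T - {e}))\<^sup>*"
          using less.prems(2) by (intro rtrancl_mono adjacent_mono) blast
        then show False
          using grown_connected[OF less.prems(1)] he not_back[OF e(1)] by blast
      qed
      with e have e': "tail G e \<in> R" "head G e \<notin> R" by blast+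
      have hT: "head G e \<in> verts T" using e(1) T.head_in_verts ends by simp
      have "grown G r (insert (head G e) R) (insert e A)"
        using sub(2) e by (intro grown.step[OF less.prems(1)] e') blast
      moreover have "card (verts T - insert (head G e) R) < card (verts T - R)"
      proof -
        have "finite (verts T)" using sub(1) finite_subset finite_verts by blast
        moreover have "head G e \<in> verts T - R" using hT e' by blast
        ultimately show ?thesis by (metis Diff_insert card_Diff1_less finite_Diff)
      qed
      moreover have "insert e A \<subseteq> arcs T" "insert (head G e) R \<subseteq> verts T"
        using less.prems(2,3) e(1) hT by blast+
      ultimately show ?thesis by (intro less.hyps)
    qed
  qed
  obtain A where A: "grown G r (verts T) A" "A \<subseteq> arcs T"
    using grow[OF grown.root] r by blast
  have "e \<in> A" if e: "e \<in> arcs T" for e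
  proof (rule ccontr)
    assume "e \<notin> A"
    then have "(adjacent G A)\<^sup>* \<subseteq> (adjacent G (arcs T - {e}))\<^sup>*"
      using A(2) by (intro rtrancl_mono adjacent_mono) blast
    moreover have "(r, head G e) \<in> (adjacent G A)\<^sup>*"
      using e T.head_in_verts ends by (intro grown_connected[OF A(1)]) simp
    ultimately show False using not_back[OF e] by blast
  qed
  then have "A = arcs T" using A(2) by blast
  with A(1) show ?thesis by simp
qed

lemma branching_greedoid_eq:
  assumes "r \<in> verts G"
  shows "branching_greedoid G r = {A. \<exists>R. grown G r R A}"
proof (intro equalityI subsetI)
  fix A assume "A \<in> branching_greedoid G r"
  then show "A \<in> {A. \<exists>R. grown G r R A}"
    using arborescence_grown unfolding branching_greedoid_def by blast
next
  fix A assume "A \<in> {A. \<exists>R. grown G r R A}"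
  then obtain R where "grown G r R A" by blast
  from grown_arborescence[OF this assms] show "A \<in> branching_greedoid G r"
    unfolding branching_greedoid_def by force
qed

lemma branching_bases_eq:
  assumes "eulerian G" "Digraph_Component.connected G" "r \<in> verts G"
  shows "greedoid_bases (branching_greedoid G r) = {A. grown G r (verts G) A}"
proof (intro equalityI subsetI)
  fix A assume "A \<in> greedoid_bases (branching_greedoid G r)"
  then obtain R where R: "grown G r R A" and max: "\<And>C R'. grown G r R' C \<Longrightarrow> A \<subseteq> C \<Longrightarrow> C = A"
    unfolding greedoid_bases_def branching_greedoid_eq[OF assms(3)] by blast
  have "R = verts G"
  proof (rule ccontr)
    assume "R \<noteq> verts G"
    then obtain e where e: "e \<in> arcs G" "tail G e \<in> R" "head G e \<notin> R"
      by (rule grown_extend[OF assms R])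
    then have "insert e A = A" by (intro max[OF grown.step[OF R]]) auto
    then show False using grown_facts(7)[OF R] e(3) by blast
  qed
  with R show "A \<in> {A. grown G r (verts G) A}" by simp
next
  fix A assume "A \<in> {A. grown G r (verts G) A}"
  then have A: "grown G r (verts G) A" by simp
  have "C = A" if C: "grown G r R C" "A \<subseteq> C" for C R
  proof -
    have "card R \<le> card (verts G)" by (rule card_mono[OF finite_verts grown_verts[OF C(1) assms(3)]])
    then have "card C \<le> card A" using grown_facts(5)[OF A] grown_facts(5)[OF C(1)] by simp
    then show ?thesis using card_seteq[OF grown_facts(4)[OF C(1)] C(2)] by simp
  qed
  then show "A \<in> greedoid_bases (branching_greedoid G r)"
    unfolding greedoid_bases_def branching_greedoid_eq[OF assms(3)] using A by blast
qed

end

section \<open>Counting lattice points through supports\<close>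

text \<open>
  The lattice points in the relative interior of the cone spanned by the coordinate vectors in \<open>F\<close>, at
  height \<open>k\<close>.
\<close>
definition supported :: "'a set \<Rightarrow> nat \<Rightarrow> ('a \<Rightarrow> nat) set"
  where "supported F k = {x. {e. x e \<noteq> 0} = F \<and> sum x F = k}"

text \<open>
  Lowering the value at \<open>e\<close> by one either removes \<open>e\<close> from the support or keeps it. This is the
  identity \<open>(1 - t) * g = t * f\<close> for the generating functions \<open>f\<close> of \<open>F\<close> and \<open>g\<close> of \<open>insert e F\<close>.
\<close>
lemma supported_insert_Suc:
  assumes "finite F" "e \<notin> F"
  shows "bij_betw (\<lambda>x. x(e := x e - 1)) (supported (insert e F) (Suc k))
    (supported F k \<union> supported (insert e F) k)"
proof (rule bij_betw_byWitness[where f' = "\<lambda>x. x(e := Suc (x e))"])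
  have sum_upd: "sum (x(e := a)) F = sum x F" for x :: "'a \<Rightarrow> nat" and a
    using assms(2) by (intro sum.cong) auto
  show "\<forall>x\<in>supported (insert e F) (Suc k). (x(e := x e - 1))(e := Suc ((x(e := x e - 1)) e)) = x"
  proof
    fix x assume "x \<in> supported (insert e F) (Suc k)"
    then have "x e \<noteq> 0" by (auto simp: supported_def)
    then show "(x(e := x e - 1))(e := Suc ((x(e := x e - 1)) e)) = x" by (simp add: fun_eq_iff)
  qed
  show "\<forall>x\<in>supported F k \<union> supported (insert e F) k.
      (x(e := Suc (x e)))(e := (x(e := Suc (x e))) e - 1) = x"
    by auto
  show "(\<lambda>x. x(e := x e - 1)) ` supported (insert e F) (Suc k)
      \<subseteq> supported F k \<union> supported (insert e F) k"
  proof
    fix y assume "y \<in> (\<lambda>x. x(e := x e - 1)) ` supported (insert e F) (Suc k)"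
    then obtain x where x: "{a. x a \<noteq> 0} = insert e F" "sum x (insert e F) = Suc k"
      and y: "y = x(e := x e - 1)" by (auto simp: supported_def)
    have xe: "x e \<noteq> 0" and xF: "\<And>a. a \<noteq> e \<Longrightarrow> x a \<noteq> 0 \<longleftrightarrow> a \<in> F" using x(1) by auto
    have ye: "x e + sum x F = Suc k" using x(2) assms by simp
    show "y \<in> supported F k \<union> supported (insert e F) k"
    proof (cases "x e = 1")
      case True
      then have "{a. y a \<noteq> 0} = F" using xF assms(2) y by auto
      then show ?thesis using True ye sum_upd unfolding supported_def y by simp
    next
      case False
      then have "{a. y a \<noteq> 0} = insert e F" using xF xe y by auto
      moreover have "sum y (insert e F) = k" using ye xe assms sum_upd by (simp add: y)
      ultimately show ?thesis unfolding supported_def by simp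
    qed
  qed
  show "(\<lambda>x. x(e := Suc (x e))) ` (supported F k \<union> supported (insert e F) k)
      \<subseteq> supported (insert e F) (Suc k)"
  proof
    fix y assume "y \<in> (\<lambda>x. x(e := Suc (x e))) ` (supported F k \<union> supported (insert e F) k)"
    then obtain x where x: "x \<in> supported F k \<union> supported (insert e F) k" and y: "y = x(e := Suc (x e))"
      by blast
    have "\<And>a. a \<noteq> e \<Longrightarrow> x a \<noteq> 0 \<longleftrightarrow> a \<in> F" using x by (auto simp: supported_def)
    then have "{a. y a \<noteq> 0} = insert e F" using y by auto
    moreover have "x e + sum x F = k"
      using x assms by (auto simp: supported_def)
    then have "sum y (insert e F) = Suc k" using assms sum_upd by (simp add: y)
    ultimately show "y \<in> supported (insert e F) (Suc k)" unfolding supported_def by simp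
  qed
qed

lemma supported_0: "finite F \<Longrightarrow> supported F 0 = (if F = {} then {\<lambda>_. 0} else {})"
  by (auto simp: supported_def fun_eq_iff)

lemma supported_empty: "supported {} k = (if k = 0 then {\<lambda>_. 0} else {})"
  by (auto simp: supported_def fun_eq_iff)

lemma finite_supported: "finite F \<Longrightarrow> finite (supported F k)"
proof (induction F arbitrary: k rule: finite_induct)
  case (insert e F)
  show ?case
  proof (induction k)
    case (Suc k)
    then show ?case
      using bij_betw_finite[OF supported_insert_Suc[OF insert.hyps, of k]] insert.IH by simp
  qed (use insert.hyps in \<open>simp add: supported_0\<close>)
qed (simp add: supported_empty)

lemma supported_fps:
  assumes "finite F"
  shows "(1 - fps_X) ^ card F * Abs_fps (\<lambda>k. of_nat (card (supported F k))) = (fps_X ^ card F :: real fps)"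
  using assms
proof (induction F rule: finite_induct)
  case empty
  have "Abs_fps (\<lambda>k. of_nat (card (supported {} k))) = (1 :: real fps)"
    by (rule fps_ext) (simp add: supported_empty)
  then show ?case by simp
next
  case (insert e F)
  define a b where "a = Abs_fps (\<lambda>k. of_nat (card (supported F k)) :: real)"
    and "b = Abs_fps (\<lambda>k. of_nat (card (supported (insert e F) k)) :: real)"
  have "(1 - fps_X) * b = fps_X * a"
  proof (rule fps_ext)
    fix k
    show "fps_nth ((1 - fps_X) * b) k = fps_nth (fps_X * a) k"
    proof (cases k)
      case 0
      then show ?thesis using insert.hyps by (simp add: b_def supported_0)
    next
      case (Suc m)
      have "supported F m \<inter> supported (insert e F) m = {}"
        using insert.hyps by (auto simp: supported_def)
      then have "card (supported (insert e F) (Suc m)) = card (supported F m) + card (supported (insert e F) m)"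
        using bij_betw_same_card[OF supported_insert_Suc[OF insert.hyps, of m]]
          finite_supported[of F m] finite_supported[of "insert e F" m] insert.hyps
        by (simp add: card_Un_disjoint)
      then show ?thesis using Suc by (simp add: left_diff_distrib a_def b_def)
    qed
  qed
  moreover have "(1 - fps_X) ^ card (insert e F) * b = (1 - fps_X) ^ card F * ((1 - fps_X) * b)"
    using insert.hyps by (simp add: mult_ac)
  ultimately have "(1 - fps_X) ^ card (insert e F) * b = fps_X * ((1 - fps_X) ^ card F * a)"
    by (simp add: mult_ac)
  then show ?case using insert unfolding a_def b_def by simp
qed

lemma convex_hull_image:
  fixes f :: "'a \<Rightarrow> 'b::real_vector"
  assumes "finite S"
  shows "convex hull (f ` S) = {\<Sum>s\<in>S. u s *\<^sub>R f s |u. (\<forall>s\<in>S. 0 \<le> u s) \<and> sum u S = 1}" (is "_ = ?T")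
proof
  show "convex hull (f ` S) \<subseteq> ?T"
  proof (rule hull_minimal)
    show "f ` S \<subseteq> ?T"
    proof
      fix y assume "y \<in> f ` S"
      then obtain s where "s \<in> S" "y = f s" by blast
      then show "y \<in> ?T"
        using assms
        by (intro CollectI exI[of _ "\<lambda>t. if t = s then 1 else 0"]) (simp add: if_distrib[of "\<lambda>c. c *\<^sub>R _"] cong: if_cong)
    qed
    show "convex ?T"
    proof (rule convexI)
      fix x y and a b :: real assume "x \<in> ?T" "y \<in> ?T" and ab: "0 \<le> a" "0 \<le> b" "a + b = 1"
      then obtain u v where u: "\<forall>s\<in>S. 0 \<le> u s" "sum u S = 1" "x = (\<Sum>s\<in>S. u s *\<^sub>R f s)"
        and v: "\<forall>s\<in>S. 0 \<le> v s" "sum v S = 1" "y = (\<Sum>s\<in>S. v s *\<^sub>R f s)" by blast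
      have eq: "a *\<^sub>R x + b *\<^sub>R y = (\<Sum>s\<in>S. (a * u s + b * v s) *\<^sub>R f s)"
        by (simp add: u v scaleR_sum_right sum.distrib scaleR_left_distrib)
      have one: "sum (\<lambda>s. a * u s + b * v s) S = 1"
        using u v ab by (simp add: sum.distrib flip: sum_distrib_left)
      have nn: "\<forall>s\<in>S. 0 \<le> a * u s + b * v s" using u v ab by simp
      show "a *\<^sub>R x + b *\<^sub>R y \<in> ?T"
        by (intro CollectI exI[of _ "\<lambda>s. a * u s + b * v s"] conjI eq one nn)
    qed
  qed
  show "?T \<subseteq> convex hull (f ` S)"
  proof
    fix y assume "y \<in> ?T"
    then obtain u where u: "\<forall>s\<in>S. 0 \<le> u s" "sum u S = 1" "y = (\<Sum>s\<in>S. u s *\<^sub>R f s)" by blast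
    show "y \<in> convex hull (f ` S)"
      unfolding u(3) by (rule convex_sum[OF assms convex_convex_hull u(2)]) (simp_all add: u(1) hull_inc)
  qed
qed

section \<open>The root polytope of the dual\<close>

text \<open>
  All that the root polytope sees of the drawing is that the circulations of \<open>G\<close> are the coboundaries
  of \<open>H\<close>, over the integers.
\<close>
locale dual_pair = fin_digraph G for G :: "('v, 'e) pre_digraph" (structure) +
  fixes r :: 'v and H :: "('f::finite, 'e) pre_digraph"
  assumes eulerian: "eulerian G" and conn: "Digraph_Component.connected G" and r: "r \<in> verts G"
    and arcs_H: "arcs H = arcs G"
    and circulation_imp_coboundary: "circulation G (x :: 'e \<Rightarrow> int) \<Longrightarrow>
      \<exists>\<phi> :: 'f \<Rightarrow> int. \<forall>e\<in>arcs G. \<phi> (head H e) - \<phi> (tail H e) = x e"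
    and coboundary_imp_circulation: "circulation G (\<lambda>e. \<phi> (head H e) - \<phi> (tail H e) :: int)"
begin

definition root_vec :: "'e \<Rightarrow> real ^ 'f"
  where "root_vec e = axis (head H e) 1 - axis (tail H e) 1"

definition comb :: "('e \<Rightarrow> real) \<Rightarrow> real ^ 'f"
  where "comb y = (\<Sum>e\<in>arcs G. y e *\<^sub>R root_vec e)"

lemma comb_diff: "comb (\<lambda>e. y e - z e) = comb y - comb z"
  by (simp add: comb_def scaleR_left_diff_distrib sum_subtractf)

lemma comb_component: "comb y $ i = (\<Sum>e\<in>arcs G. y e * root_vec e $ i)"
  by (simp add: comb_def sum_component)

lemma root_vec_component:
  "root_vec e $ i = of_int ((if head H e = i then 1 else 0) - (if tail H e = i then 1 else 0))"
  by (simp add: root_vec_def axis_def)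

lemma comb_coboundary: "comb (\<lambda>e. q (head G e) - q (tail G e)) = 0"
proof -
  have "(\<Sum>e\<in>arcs G. root_vec e $ i * (q (head G e) - q (tail G e))) = 0" for i
    unfolding root_vec_component
    by (rule circulation_orthogonal[OF circulation_of_int[OF
          coboundary_imp_circulation[of "\<lambda>j. if j = i then 1 else 0"]]])
  then show ?thesis by (simp add: vec_eq_iff comb_component mult.commute)
qed

lemma circulation_functional:
  assumes "circulation G x"
  shows "\<exists>p :: int ^ 'f. \<forall>y. (\<Sum>i\<in>UNIV. of_int (p $ i) * comb y $ i) = (\<Sum>e\<in>arcs G. of_int (x e) * y e)"
proof -
  obtain \<phi> :: "'f \<Rightarrow> int" where \<phi>: "\<And>e. e \<in> arcs G \<Longrightarrow> \<phi> (head H e) - \<phi> (tail H e) = x e"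
    using circulation_imp_coboundary[OF assms] by blast
  have "(\<Sum>i\<in>UNIV. of_int (\<phi> i) * root_vec e $ i) = of_int (x e)" if "e \<in> arcs G" for e
    unfolding \<phi>[OF that, symmetric]
    by (simp add: root_vec_def axis_def right_diff_distrib sum_subtractf
        if_distrib[of "\<lambda>c. _ * c"] cong: if_cong)
  moreover have "(\<Sum>i\<in>UNIV. of_int (\<phi> i) * comb y $ i)
      = (\<Sum>e\<in>arcs G. y e * (\<Sum>i\<in>UNIV. of_int (\<phi> i) * root_vec e $ i))" for y
    unfolding comb_component sum_distrib_left
    by (subst sum.swap) (simp add: mult.left_commute)
  ultimately have "(\<Sum>i\<in>UNIV. of_int ((\<chi> i. \<phi> i) $ i) * comb y $ i) = (\<Sum>e\<in>arcs G. of_int (x e) * y e)" for y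
    by (simp add: mult.commute)
  then show ?thesis by blast
qed

text \<open>
  The circulation through \<open>e\<close> and otherwise only along the tree, that is, the fundamental cycle of \<open>e\<close>.
\<close>
lemma off_tree_circulation:
  assumes "grown G r (verts G) A" "e \<in> arcs G - A"
  shows "\<exists>x :: 'e \<Rightarrow> int. circulation G x \<and>
    (\<forall>y :: 'e \<Rightarrow> real. (\<forall>f\<in>A. y f = 0) \<longrightarrow> (\<Sum>f\<in>arcs G. of_int (x f) * y f) = y e)"
proof -
  obtain x :: "'e \<Rightarrow> int" where x: "circulation G x" "\<And>f. f \<notin> A \<Longrightarrow> x f = (if f = e then 1 else 0)"
    using circulation_extending[OF assms(1), of "\<lambda>f. if f = e then 1 else 0"] by blast
  have "(\<Sum>f\<in>arcs G. of_int (x f) * y f) = y e" if "\<forall>f\<in>A. y f = 0" for y :: "'e \<Rightarrow> real"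
  proof -
    have "(\<Sum>f\<in>arcs G. of_int (x f) * y f) = (\<Sum>f\<in>arcs G. if f = e then y f else 0)"
      using x(2) that by (intro sum.cong refl) (metis mult_eq_0_iff mult_1 of_int_0 of_int_1)
    then show ?thesis using assms(2) by simp
  qed
  with x(1) show ?thesis by blast
qed

lemma spanning_grown_exists: obtains A where "grown G r (verts G) A"
  using normal_form_exists[OF eulerian conn r, of "\<lambda>_. 0"] that by auto

text \<open>
  After subtraction of a potential difference \<open>z\<close> vanishes on a tree. Pairing with the fundamental
  cycles then shows that it vanishes everywhere.
\<close>
lemma comb_eq_0_imp_coboundary:
  assumes "comb z = 0"
  shows "\<exists>q. \<forall>e\<in>arcs G. z e = q (head G e) - q (tail G e)"
proof -
  obtain A where A: "grown G r (verts G) A" by (rule spanning_grown_exists)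
  obtain q where q: "\<And>e. e \<in> A \<Longrightarrow> q (head G e) - q (tail G e) = z e"
    using grown_potential[OF A, of z] by blast
  define y where "y e = z e - (q (head G e) - q (tail G e))" for e
  have y0: "y e = 0" if "e \<in> A" for e using q[OF that] by (simp add: y_def)
  have "comb y = comb z - comb (\<lambda>e. q (head G e) - q (tail G e))" unfolding y_def by (rule comb_diff)
  then have "comb y = 0" by (simp add: comb_coboundary assms)
  have "y e = 0" if "e \<in> arcs G" for e
  proof (cases "e \<in> A")
    case False
    with that have "e \<in> arcs G - A" by simp
    then obtain x :: "'e \<Rightarrow> int" where x: "circulation G x"
      "\<And>y :: 'e \<Rightarrow> real. \<forall>f\<in>A. y f = 0 \<Longrightarrow> (\<Sum>f\<in>arcs G. of_int (x f) * y f) = y e"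
      using off_tree_circulation[OF A] by blast
    obtain p :: "int ^ 'f" where
      p: "\<And>y. (\<Sum>i\<in>UNIV. of_int (p $ i) * comb y $ i) = (\<Sum>e\<in>arcs G. of_int (x e) * y e)"
      using circulation_functional[OF x(1)] by blast
    have "(\<Sum>i\<in>UNIV. of_int (p $ i) * comb y $ i) = y e" unfolding p using x(2) y0 by blast
    then show ?thesis using \<open>comb y = 0\<close> by simp
  qed (rule y0)
  then show ?thesis unfolding y_def by (intro exI[of _ q]) simp
qed

text \<open>
  The unimodularity of the simplices: the coefficient of \<open>e\<close> is an integral linear functional of the
  point, given by the fundamental cycle of \<open>e\<close>.
\<close>
lemma comb_Ints_imp_Ints:
  assumes A: "grown G r (verts G) A" and y0: "\<And>f. f \<in> A \<Longrightarrow> y f = 0"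
    and int: "\<And>i. comb y $ i \<in> \<int>" and e: "e \<in> arcs G"
  shows "y e \<in> \<int>"
proof (cases "e \<in> A")
  case False
  with e have "e \<in> arcs G - A" by simp
  then obtain x :: "'e \<Rightarrow> int" where x: "circulation G x"
    "\<And>y :: 'e \<Rightarrow> real. \<forall>f\<in>A. y f = 0 \<Longrightarrow> (\<Sum>f\<in>arcs G. of_int (x f) * y f) = y e"
    using off_tree_circulation[OF A] by blast
  obtain p :: "int ^ 'f" where
    p: "\<And>y. (\<Sum>i\<in>UNIV. of_int (p $ i) * comb y $ i) = (\<Sum>e\<in>arcs G. of_int (x e) * y e)"
    using circulation_functional[OF x(1)] by blast
  have "(\<Sum>i\<in>UNIV. of_int (p $ i) * comb y $ i) = y e" unfolding p using x(2) y0 by blast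
  moreover have "(\<Sum>i\<in>UNIV. of_int (p $ i) * comb y $ i) \<in> \<int>" using int by (intro Ints_sum Ints_mult) auto
  ultimately show ?thesis by simp
qed (simp add: y0)

text \<open>
  The sum of the coefficients is the height of a point above the hyperplane through the
  origin parallel to the root polytope, so it must not depend on the representative.
\<close>
lemma sum_coboundary_0:
  fixes q :: "'v \<Rightarrow> real"
  shows "(\<Sum>e\<in>arcs G. q (head G e) - q (tail G e)) = 0"
  using circulation_orthogonal[of "\<lambda>_. 1 :: real" q] eulerian
  by (simp add: eulerian_iff_circulation[where 'a=real])

lemma root_polytope_eq:
  "root_polytope H = {comb u |u. (\<forall>e\<in>arcs G. 0 \<le> u e) \<and> sum u (arcs G) = 1}"
  unfolding root_polytope_def arcs_H comb_def root_vec_def[symmetric]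
  by (rule convex_hull_image) simp

definition complement_complex :: "'e set set"
  where "complement_complex = {F. \<exists>A. grown G r (verts G) A \<and> F \<subseteq> arcs G - A}"

definition normal_points :: "nat \<Rightarrow> ('e \<Rightarrow> nat) set"
  where "normal_points k = (\<Union>F\<in>complement_complex. supported F k)"

lemma finite_complement_complex: "finite complement_complex"
  unfolding complement_complex_def by (rule finite_subset[of _ "Pow (arcs G)"]) auto

lemma normal_pointD:
  assumes "x \<in> normal_points k"
  shows "\<exists>A. grown G r (verts G) A \<and> (\<forall>e\<in>A. x e = 0) \<and> (\<forall>e. e \<notin> arcs G \<longrightarrow> x e = 0) \<and>
    sum x (arcs G) = k"
proof -
  obtain F where F: "F \<in> complement_complex" "{e. x e \<noteq> 0} = F" "sum x F = k"
    using assms unfolding normal_points_def supported_def by blast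
  then obtain A where A: "grown G r (verts G) A" "F \<subseteq> arcs G - A"
    unfolding complement_complex_def by blast
  have zero: "x e = 0" if "e \<notin> F" for e using F(2) that by blast
  have "sum x (arcs G) = k"
    unfolding F(3)[symmetric] using A(2) zero by (intro sum.mono_neutral_right) auto
  moreover have "x e = 0" if "e \<in> A" for e using A(2) that by (intro zero) blast
  moreover have "x e = 0" if "e \<notin> arcs G" for e using A(2) that by (intro zero) blast
  ultimately show ?thesis using A(1) by blast
qed

lemma normal_pointI:
  assumes "grown G r (verts G) A" "\<And>e. e \<in> A \<Longrightarrow> x e = 0" "\<And>e. e \<notin> arcs G \<Longrightarrow> x e = 0"
    "sum x (arcs G) = k"
  shows "x \<in> normal_points k"
proof -
  have sub: "{e. x e \<noteq> 0} \<subseteq> arcs G - A"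
  proof
    fix e assume "e \<in> {e. x e \<noteq> 0}"
    then show "e \<in> arcs G - A" using assms(2)[of e] assms(3)[of e] by (cases "e \<in> arcs G") auto
  qed
  then have "{e. x e \<noteq> 0} \<in> complement_complex"
    unfolding complement_complex_def using assms(1) by (intro CollectI exI[of _ A] conjI)
  moreover have "sum x {e. x e \<noteq> 0} = sum x (arcs G)"
    using sub by (intro sum.mono_neutral_left) auto
  then have "x \<in> supported {e. x e \<noteq> 0} k" using assms(4) by (simp add: supported_def)
  ultimately show ?thesis unfolding normal_points_def by (rule UN_I)
qed

lemma normal_points_bij:
  assumes k: "0 < k"
  shows "bij_betw (\<lambda>x. comb (\<lambda>e. real (x e))) (normal_points k)
    {x \<in> (\<lambda>y. real k *\<^sub>R y) ` root_polytope H. \<forall>i. x $ i \<in> \<int>}" (is "bij_betw ?f _ ?L")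
proof (rule bij_betw_imageI)
  show "inj_on ?f (normal_points k)"
  proof (rule inj_onI)
    fix x x' assume x: "x \<in> normal_points k" and x': "x' \<in> normal_points k" and eq: "?f x = ?f x'"
    obtain A where A: "grown G r (verts G) A" "\<And>e. e \<in> A \<Longrightarrow> x e = 0" "\<And>e. e \<notin> arcs G \<Longrightarrow> x e = 0"
      using normal_pointD[OF x] by blast
    obtain A' where A': "grown G r (verts G) A'" "\<And>e. e \<in> A' \<Longrightarrow> x' e = 0" "\<And>e. e \<notin> arcs G \<Longrightarrow> x' e = 0"
      using normal_pointD[OF x'] by blast
    have "comb (\<lambda>e. real (x e) - real (x' e)) = 0" using eq by (simp add: comb_diff)
    then obtain q where q: "\<And>e. e \<in> arcs G \<Longrightarrow> real (x e) - real (x' e) = q (head G e) - q (tail G e)"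
      using comb_eq_0_imp_coboundary by blast
    have "real (x e) = real (x' e)" if "e \<in> arcs G" for e
      using A(2) A'(2) q that
      by (intro normal_form_unique[OF A(1) A'(1), of "\<lambda>e. real (x e)" "\<lambda>e. real (x' e)" q]) auto
    then show "x = x'" using A(3) A'(3) by (metis ext of_nat_eq_iff)
  qed
  show "?f ` normal_points k = ?L"
  proof (intro equalityI subsetI)
    fix p assume "p \<in> ?f ` normal_points k"
    then obtain x where x: "x \<in> normal_points k" and p: "p = ?f x" by blast
    have "sum x (arcs G) = k" using normal_pointD[OF x] by blast
    then have "sum (\<lambda>e. real (x e)) (arcs G) = real k" by (simp flip: of_nat_sum)
    then have "sum (\<lambda>e. real (x e) / real k) (arcs G) = 1" using k by (simp flip: sum_divide_distrib)
    then have "comb (\<lambda>e. real (x e) / real k) \<in> root_polytope H"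
      unfolding root_polytope_eq by (intro CollectI exI[of _ "\<lambda>e. real (x e) / real k"]) simp
    moreover have "p = real k *\<^sub>R comb (\<lambda>e. real (x e) / real k)"
      using k by (simp add: p comb_def scaleR_sum_right)
    moreover have "p $ i \<in> \<int>" for i
      unfolding p comb_component root_vec_component by (intro Ints_sum Ints_mult) auto
    ultimately show "p \<in> ?L" by blast
  next
    fix p assume p: "p \<in> ?L"
    then obtain u where u: "\<And>e. e \<in> arcs G \<Longrightarrow> 0 \<le> u e" "sum u (arcs G) = 1" "p = real k *\<^sub>R comb u"
      unfolding root_polytope_eq by auto
    define y where "y e = real k * u e" for e
    have p_y: "p = comb y" by (simp add: u(3) y_def comb_def scaleR_sum_right)
    have sum_y: "sum y (arcs G) = real k" by (simp add: y_def u(2) flip: sum_distrib_left)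
    have nn_y: "0 \<le> y e" if "e \<in> arcs G" for e using u(1)[OF that] by (simp add: y_def)
    obtain q A where A: "grown G r (verts G) A"
      and nn: "\<And>e. e \<in> arcs G \<Longrightarrow> 0 \<le> y e - (q (head G e) - q (tail G e))"
      and z: "\<And>e. e \<in> A \<Longrightarrow> y e - (q (head G e) - q (tail G e)) = 0"
      using normal_form_exists[OF eulerian conn r, of y] nn_y by blast
    define y' where "y' e = y e - (q (head G e) - q (tail G e))" for e
    have "comb y' = comb y - comb (\<lambda>e. q (head G e) - q (tail G e))"
      unfolding y'_def by (rule comb_diff)
    then have p_y': "p = comb y'" by (simp add: p_y comb_coboundary)
    have sum_y': "sum y' (arcs G) = real k"
      using sum_y sum_coboundary_0[of q] by (simp add: y'_def sum_subtractf)
    have "y' e \<in> \<int>" if "e \<in> arcs G" for e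
      using comb_Ints_imp_Ints[OF A, of y' e] z p that by (auto simp: y'_def[symmetric] p_y')
    then have nat: "real (nat \<lfloor>y' e\<rfloor>) = y' e" if "e \<in> arcs G" for e
      using nn[OF that] that by (auto simp: y'_def[symmetric] elim: Ints_cases)
    define x where "x e = (if e \<in> arcs G then nat \<lfloor>y' e\<rfloor> else 0)" for e
    have xy: "real (x e) = y' e" if "e \<in> arcs G" for e using nat[OF that] that by (simp add: x_def)
    have "real (sum x (arcs G)) = real k" using xy sum_y' by simp
    then have "sum x (arcs G) = k" by (simp only: of_nat_eq_iff)
    moreover have "x e = 0" if "e \<in> A" for e using z[OF that] by (simp add: x_def y'_def)
    moreover have "x e = 0" if "e \<notin> arcs G" for e using that by (simp add: x_def)
    ultimately have "x \<in> normal_points k" by (intro normal_pointI[OF A])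
    moreover have "p = ?f x" using xy by (simp add: p_y' comb_def)
    ultimately show "p \<in> ?f ` normal_points k" by blast
  qed
qed

lemma card_grown_complement:
  assumes "grown G r (verts G) A"
  shows "card (arcs G - A) = card (arcs G) + 1 - card (verts G)"
  using grown_facts(2,4,5)[OF assms] by (simp add: card_Diff_subset)

text \<open>
  The vectors of the arcs off a tree are independent by the coordinates of the fundamental cycles, and
  the remaining ones are affine combinations of them, since coefficients can be moved off
  the tree by a potential without change of their sum.
\<close>
lemma aff_dim_root_polytope:
  "aff_dim (root_polytope H) = int (card (arcs G) + 1 - card (verts G)) - 1"
proof -
  obtain A where A: "grown G r (verts G) A" by (rule spanning_grown_exists)
  define B where "B = arcs G - A"
  have finB: "finite B" by (simp add: B_def)
  have coord: "\<exists>p. \<forall>f\<in>B. (\<Sum>i\<in>UNIV. of_int (p $ i) * root_vec f $ i) = (if f = e then 1 else 0)"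
    if eB: "e \<in> B" for e
  proof -
    obtain x :: "'e \<Rightarrow> int" where x: "circulation G x"
      "\<And>y :: 'e \<Rightarrow> real. \<forall>f\<in>A. y f = 0 \<Longrightarrow> (\<Sum>f\<in>arcs G. of_int (x f) * y f) = y e"
      using off_tree_circulation[OF A eB[unfolded B_def]] by blast
    obtain p :: "int ^ 'f" where p: "\<And>y. (\<Sum>i\<in>UNIV. of_int (p $ i) * comb y $ i) = (\<Sum>e\<in>arcs G. of_int (x e) * y e)"
      using circulation_functional[OF x(1)] by blast
    have "(\<Sum>i\<in>UNIV. of_int (p $ i) * root_vec f $ i) = (if f = e then 1 else 0)" if f: "f \<in> B" for f
    proof -
      define y :: "'e \<Rightarrow> real" where "y g = (if g = f then 1 else 0)" for g
      have "comb y = root_vec f"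
        using f by (simp add: comb_def y_def B_def if_distrib[of "\<lambda>c. c *\<^sub>R _"] cong: if_cong)
      moreover have "(\<Sum>g\<in>arcs G. of_int (x g) * y g) = y e"
        using f by (intro x(2)) (auto simp: y_def B_def)
      ultimately show ?thesis using p[of y] by (simp add: y_def)
    qed
    then show ?thesis by blast
  qed
  have inj: "inj_on root_vec B"
  proof (rule inj_onI)
    fix e f assume ef: "e \<in> B" "f \<in> B" "root_vec e = root_vec f"
    obtain p where p: "\<And>f. f \<in> B \<Longrightarrow> (\<Sum>i\<in>UNIV. of_int (p $ i) * root_vec f $ i) = (if f = e then 1 else 0)"
      using coord[OF ef(1)] by blast
    have "(if f = e then 1 else 0) = (1 :: real)"
      using p[OF ef(1)] unfolding ef(3) p[OF ef(2)] by simp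
    then show "e = f" by (auto split: if_splits)
  qed
  have "independent (root_vec ` B)"
  proof (rule independent_if_scalars_zero)
    fix c v assume c: "(\<Sum>v\<in>root_vec ` B. c v *\<^sub>R v) = 0" and v: "v \<in> root_vec ` B"
    then obtain e where e: "e \<in> B" "v = root_vec e" by blast
    obtain p where p: "\<And>f. f \<in> B \<Longrightarrow> (\<Sum>i\<in>UNIV. of_int (p $ i) * root_vec f $ i) = (if f = e then 1 else 0)"
      using coord[OF e(1)] by blast
    have "(\<Sum>f\<in>B. c (root_vec f) *\<^sub>R root_vec f) = 0" using c by (simp add: sum.reindex[OF inj])
    then have "(\<Sum>i\<in>UNIV. of_int (p $ i) * (\<Sum>f\<in>B. c (root_vec f) * root_vec f $ i)) = 0"
      by (simp add: vec_eq_iff sum_component)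
    moreover have "(\<Sum>i\<in>UNIV. of_int (p $ i) * (\<Sum>f\<in>B. c (root_vec f) * root_vec f $ i))
        = (\<Sum>f\<in>B. c (root_vec f) * (\<Sum>i\<in>UNIV. of_int (p $ i) * root_vec f $ i))"
      unfolding sum_distrib_left by (subst sum.swap) (simp add: mult.left_commute)
    moreover have "\<dots> = (\<Sum>f\<in>B. if f = e then c (root_vec f) else 0)"
      using p by (intro sum.cong refl) simp
    ultimately show "c v = 0" using e finB by simp
  qed (simp add: finB)
  then have "\<not> affine_dependent (root_vec ` B)" using affine_dependent_imp_dependent by blast
  then have "aff_dim (root_vec ` B) = int (card (root_vec ` B)) - 1" by (simp add: aff_dim_affine_independent)
  moreover have "card (root_vec ` B) = card (arcs G) + 1 - card (verts G)"
    using card_grown_complement[OF A] by (simp add: card_image[OF inj] flip: B_def)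
  moreover have "aff_dim (root_polytope H) = aff_dim (root_vec ` B)"
  proof (rule antisym)
    have "root_vec ` arcs G \<subseteq> affine hull (root_vec ` B)"
    proof
      fix v assume "v \<in> root_vec ` arcs G"
      then obtain e where e: "e \<in> arcs G" "v = root_vec e" by blast
      define z :: "'e \<Rightarrow> real" where "z f = (if f = e then 1 else 0)" for f
      obtain q where q: "\<And>f. f \<in> A \<Longrightarrow> q (head G f) - q (tail G f) = z f"
        using grown_potential[OF A, of z] by blast
      define y where "y f = z f - (q (head G f) - q (tail G f))" for f
      have y0: "y f = 0" if "f \<in> A" for f using q[OF that] by (simp add: y_def)
      have "comb z = v"
        using e by (simp add: comb_def z_def if_distrib[of "\<lambda>c. c *\<^sub>R _"] cong: if_cong)
      moreover have "comb y = comb z - comb (\<lambda>f. q (head G f) - q (tail G f))"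
        unfolding y_def by (rule comb_diff)
      ultimately have "comb y = v" by (simp add: comb_coboundary)
      moreover have "comb y = (\<Sum>f\<in>B. y f *\<^sub>R root_vec f)"
        unfolding comb_def B_def using y0 by (intro sum.mono_neutral_right) auto
      moreover have "sum y B = sum y (arcs G)"
        unfolding B_def using y0 by (intro sum.mono_neutral_left) auto
      moreover have "sum y (arcs G) = 1"
        using sum_coboundary_0[of q] e by (simp add: y_def sum_subtractf z_def)
      moreover define u where "u = y \<circ> inv_into B root_vec"
      moreover have "sum u (root_vec ` B) = sum y B" "(\<Sum>v\<in>root_vec ` B. u v *\<^sub>R v) = (\<Sum>f\<in>B. y f *\<^sub>R root_vec f)"
        unfolding u_def by (simp_all add: sum.reindex[OF inj] inj)
      ultimately show "v \<in> affine hull (root_vec ` B)"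
        unfolding affine_hull_finite[OF finite_imageI[OF finB]] by (intro CollectI exI[of _ u]) simp
    qed
    from aff_dim_subset[OF this] show "aff_dim (root_polytope H) \<le> aff_dim (root_vec ` B)"
      unfolding root_polytope_def arcs_H root_vec_def[symmetric] by (simp add: aff_dim_convex_hull)
    show "aff_dim (root_vec ` B) \<le> aff_dim (root_polytope H)"
      unfolding root_polytope_def arcs_H root_vec_def[symmetric] aff_dim_convex_hull
      by (rule aff_dim_subset) (auto simp: B_def)
  qed
  ultimately show ?thesis by simp
qed

lemma ehrhart_series_eq_sum:
  "ehrhart_series (root_polytope H)
    = (\<Sum>F\<in>complement_complex. Abs_fps (\<lambda>k. of_nat (card (supported F k))))"
proof (rule fps_ext)
  fix k
  have fin: "finite F" if "F \<in> complement_complex" for F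
  proof -
    have "F \<subseteq> arcs G" using that unfolding complement_complex_def by blast
    then show ?thesis using finite_arcs finite_subset by blast
  qed
  have "card (normal_points k) = (\<Sum>F\<in>complement_complex. card (supported F k))"
    unfolding normal_points_def
  proof (rule card_UN_disjoint[OF finite_complement_complex])
    show "\<forall>F\<in>complement_complex. finite (supported F k)" using fin finite_supported by blast
    show "\<forall>F\<in>complement_complex. \<forall>F'\<in>complement_complex.
        F \<noteq> F' \<longrightarrow> supported F k \<inter> supported F' k = {}"
      unfolding supported_def by blast
  qed
  moreover have "fps_nth (ehrhart_series (root_polytope H)) k = of_nat (card (normal_points k))"
  proof (cases "k = 0")
    case True
    obtain A where "grown G r (verts G) A" by (rule spanning_grown_exists)
    then have "{} \<in> complement_complex" unfolding complement_complex_def by blast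
    moreover have "supported F 0 = (if F = {} then {\<lambda>_. 0} else {})" if "F \<in> complement_complex" for F
      using fin[OF that] by (rule supported_0)
    ultimately have "normal_points 0 = {\<lambda>_. 0}" unfolding normal_points_def by auto
    then show ?thesis using True by (simp add: ehrhart_series_def)
  next
    case False
    then show ?thesis
      using bij_betw_same_card[OF normal_points_bij[of k]] by (simp add: ehrhart_series_def)
  qed
  ultimately show "fps_nth (ehrhart_series (root_polytope H)) k
      = fps_nth (\<Sum>F\<in>complement_complex. Abs_fps (\<lambda>k. of_nat (card (supported F k)))) k"
    by (simp add: fps_sum_nth)
qed

text \<open>
  A support \<open>F\<close> contributes \<open>(t / (1 - t)) ^ card F\<close> to the Ehrhart series.
\<close>
lemma h_star_eq_sum:
  defines "n \<equiv> card (arcs G) + 1 - card (verts G)"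
  shows "(1 - fps_X) ^ n * ehrhart_series (root_polytope H)
    = (\<Sum>F\<in>complement_complex. fps_X ^ card F * (1 - fps_X) ^ (n - card F))"
proof -
  have "(1 - fps_X) ^ n * Abs_fps (\<lambda>k. of_nat (card (supported F k)))
      = (fps_X ^ card F * (1 - fps_X) ^ (n - card F) :: real fps)" if F: "F \<in> complement_complex" for F
  proof -
    obtain A where A: "grown G r (verts G) A" "F \<subseteq> arcs G - A"
      using F by (auto simp: complement_complex_def)
    then have "card F \<le> card (arcs G - A)" by (intro card_mono) auto
    then have "card F \<le> n" using card_grown_complement[OF A(1)] by (simp add: n_def)
    then have eq: "(1 - fps_X :: real fps) ^ n = (1 - fps_X) ^ (n - card F) * (1 - fps_X) ^ card F"
      by (simp flip: power_add)
    have "F \<subseteq> arcs G" using A(2) by blast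
    then have fin: "finite F" using finite_arcs finite_subset by blast
    show ?thesis unfolding eq mult.assoc supported_fps[OF fin] by (rule mult.commute)
  qed
  then show ?thesis unfolding ehrhart_series_eq_sum sum_distrib_left by (rule sum.cong[OF refl])
qed

end

section \<open>Comparison of the two polynomials\<close>

lemma poly_of_fps_of_poly [simp]: "poly_of_fps (fps_of_poly p) = p"
  unfolding poly_of_fps_def by (rule the_equality) (simp_all add: fps_of_poly_eq_iff)

context dual_pair
begin

lemma dual_complex_branching_greedoid:
  "dual_complex (arcs G) (branching_greedoid G r) = complement_complex"
  unfolding dual_complex_def branching_bases_eq[OF eulerian conn r] complement_complex_def by simp

lemma poly_branching_polynomial:
  "poly (branching_polynomial G r) t
    = (\<Sum>F\<in>complement_complex. (t - 1) ^ (card (arcs G) + 1 - card (verts G) - card F))"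
proof -
  obtain A where A: "grown G r (verts G) A" by (rule spanning_grown_exists)
  have bases: "greedoid_bases (branching_greedoid G r) = {A. grown G r (verts G) A}"
    by (rule branching_bases_eq[OF eulerian conn r])
  have "poly (branching_polynomial G r) t
      = (\<Sum>F\<in>dual_complex (arcs G) (branching_greedoid G r).
          (t - 1) ^ (card (arcs G) - (card (verts G) - 1) - card F))"
    unfolding branching_polynomial_def
  proof (rule poly_greedoid_polynomial)
    show "A \<in> greedoid_bases (branching_greedoid G r)" using A bases by simp
    fix B assume "B \<in> greedoid_bases (branching_greedoid G r)"
    then have B: "grown G r (verts G) B" using bases by simp
    show "B \<subseteq> arcs G" by (rule grown_facts(2)[OF B])
    show "card B = card (verts G) - 1" using grown_facts(5)[OF B] by simp
  qed simp
  moreover have "card (arcs G) - (card (verts G) - 1) = card (arcs G) + 1 - card (verts G)"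
    using grown_facts(5)[OF A] by simp
  ultimately show ?thesis by (simp add: dual_complex_branching_greedoid)
qed

lemma card_complement_complex_le:
  assumes "F \<in> complement_complex"
  shows "card F \<le> card (arcs G) + 1 - card (verts G)"
proof -
  obtain A where A: "grown G r (verts G) A" "F \<subseteq> arcs G - A"
    using assms by (auto simp: complement_complex_def)
  then have "card F \<le> card (arcs G - A)" by (intro card_mono) auto
  then show ?thesis using card_grown_complement[OF A(1)] by simp
qed

definition h_poly :: "real poly"
  where "h_poly = (\<Sum>F\<in>complement_complex.
    monom 1 (card F) * [:1, -1:] ^ (card (arcs G) + 1 - card (verts G) - card F))"

lemma fps_of_h_poly:
  "fps_of_poly h_poly
    = (1 - fps_X) ^ (card (arcs G) + 1 - card (verts G)) * ehrhart_series (root_polytope H)"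
proof -
  have X: "fps_of_poly [:1, -1:] = (1 - fps_X :: real fps)"
    by (simp add: fps_of_poly_pCons)
  show ?thesis
    unfolding h_star_eq_sum h_poly_def
    by (simp only: fps_of_poly_sum fps_of_poly_mult fps_of_poly_power fps_of_poly_monom X
        fps_const_1_eq_1 mult_1)
qed

lemma h_star_series_root_polytope: "h_star_series (root_polytope H) = fps_of_poly h_poly"
  unfolding h_star_series_def aff_dim_root_polytope fps_of_h_poly by simp

lemma branching_polynomial_eq_h_poly:
  assumes "t \<noteq> 0"
  shows "poly (branching_polynomial G r) t
    = t ^ (card (arcs G) + 1 - card (verts G)) * poly h_poly (inverse t)"
proof -
  define n where "n = card (arcs G) + 1 - card (verts G)"
  have "t ^ n * (inverse t ^ card F * (1 - inverse t) ^ (n - card F)) = (t - 1) ^ (n - card F)"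
    if "F \<in> complement_complex" for F
  proof -
    have "card F \<le> n" using card_complement_complex_le[OF that] by (simp only: n_def)
    then have "t ^ n = t ^ card F * t ^ (n - card F)" by (simp flip: power_add)
    then have "t ^ n * (inverse t ^ card F * (1 - inverse t) ^ (n - card F))
        = (t * inverse t) ^ card F * (t * (1 - inverse t)) ^ (n - card F)"
      by (simp only: power_mult_distrib mult_ac)
    also have "\<dots> = (t - 1) ^ (n - card F)" using assms by (simp add: right_diff_distrib)
    finally show ?thesis .
  qed
  then show ?thesis
    unfolding poly_branching_polynomial h_poly_def n_def[symmetric]
    by (simp add: poly_sum poly_monom sum_distrib_left)
qed

end

lemma (in plane_digraph) dual_pair_planar_dual:
  fixes H :: "('f::finite, 'e) pre_digraph"
  assumes "Digraph_Component.connected G" "eulerian G" "r \<in> verts G"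
    and dual: "is_dual_digraph G pos curve face H"
  shows "dual_pair G r H"
proof unfold_locales
  show "arcs H = arcs G" using dual by (simp add: is_dual_digraph_def)
  show "\<exists>\<phi> :: 'f \<Rightarrow> int. \<forall>e\<in>arcs G. \<phi> (head H e) - \<phi> (tail H e) = x e"
    if "circulation G x" for x
    by (rule circulation_imp_dual_coboundary[OF dual that])
  show "circulation G (\<lambda>e. \<phi> (head H e) - \<phi> (tail H e) :: int)" for \<phi>
  proof -
    obtain A where "grown G r (verts G) A"
      using normal_form_exists[OF assms(2,1,3), of "\<lambda>_. 0"] by auto
    then show ?thesis by (rule dual_coboundary_circulation[OF dual])
  qed
qed (use assms in auto)

theorem mainTheorem7:
  fixes G :: "('v, 'e) pre_digraph"
    and pos :: "'v \<Rightarrow> complex"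
    and curve :: "'e \<Rightarrow> real \<Rightarrow> complex"
    and H :: "('f::finite, 'e) pre_digraph"
    and face :: "'f \<Rightarrow> complex set"
    and r0 :: 'v
  assumes "plane_digraph G pos curve"
    and "Digraph_Component.connected G"
    and "eulerian G"
    and "r0 \<in> verts G"
    and "is_dual_digraph G pos curve face H"
    and "digraph H"
  shows "let n = card (arcs G) + 1 - card (verts G);
             lam = branching_polynomial G r0;
             I = interior_polynomial H;
             Ehr = ehrhart_series (root_polytope H);
             P = poly_of_fps ((1 - fps_X) ^ n * Ehr)
    in fps_of_poly I = h_star_series (root_polytope H) \<and>
       fps_of_poly P = (1 - fps_X) ^ n * Ehr \<and>
       (\<forall>t::real. t \<noteq> 0 \<longrightarrow>
          poly lam t = t ^ n * poly I (inverse t) \<and>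
          t ^ n * poly I (inverse t) = t ^ n * poly P (inverse t))"
proof -
  interpret plane_digraph G pos curve by (rule assms(1))
  interpret dual_pair G r0 H by (rule dual_pair_planar_dual[OF assms(2,3,4,5)])
  have I: "interior_polynomial H = h_poly"
    by (simp add: interior_polynomial_def h_star_series_root_polytope)
  have P: "poly_of_fps ((1 - fps_X) ^ (card (arcs G) + 1 - card (verts G))
      * ehrhart_series (root_polytope H)) = h_poly"
    unfolding fps_of_h_poly[symmetric] by (rule poly_of_fps_of_poly)
  show ?thesis
    unfolding Let_def I P
    using branching_polynomial_eq_h_poly
    by (simp add: h_star_series_root_polytope fps_of_h_poly)
qed

end
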